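(* Let $D=(V(D),E(D),w)$ be a vertex-weighted oriented cycle such that $w(x)\geq 2$ for every vertex $x\in V(D)$. Then $$\operatorname{pd}(I(D))=|E(D)|-1\quad\text{and}\quad \operatorname{reg}(I(D))=\sum_{x\in V(D)}w(x)-|E(D)|+1.$$
   Context: A vertex-weighted oriented graph is a triple $D=(V(D),E(D),w)$, where $V(D)=\{x_1,\dots,x_n\}$ is a finite vertex set, $E(D)$ is a set of ordered pairs of distinct vertices such that each pair of vertices is joined by at most one edge, in only one direction, and $w:V(D)\to\{1,2,\ldots\}$ is a weight function. An edge written $uv$ is directed from its starting point $u$ to its ending point $v$. An oriented cycle is a cycle graph (on $n\ge 3$ vertices) in which all edges are oriented clockwise or all are oriented counterclockwise; i.e. up to relabelling the vertices, $E(D)=\{x_1x_2,x_2x_3,\ldots,x_{n-1}x_n,x_nx_1\}$. Put $w_j=w(x_j)$. Let $k$ be a field and $S=k[x_1,\ldots,x_n]$ with the standard grading. The edge ideal of $D$ is the ideal $I(D)=(x_ix_j^{w_j}\mid x_ix_j\in E(D))\subset S$, where $x_ix_j\in E(D)$ is directed from $x_i$ to $x_j$. For a nonzero homogeneous ideal $I\subset S$ with graded Betti numbers $\beta_{i,j}(I)$ of $I$ as an $S$-module (so $\beta_{0,j}(I)$ is the number of minimal generators of degree $j$), $\operatorname{pd}(I)=\max\{i\mid\beta_{i,j}(I)\ne0\text{ for some }j\}$ and $\operatorname{reg}(I)=\max\{j-i\mid\beta_{i,j}(I)\neq 0\}$. *)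

theory Defs
  imports Complex_Main "HOL-Library.Poly_Mapping"
begin

section \<open>The standard graded polynomial ring\<close>

text \<open>
  For a finite type \<open>'v\<close> of variables, \<open>('v, 'k) mpoly\<close> is the polynomial ring
  \<open>S = 'k[x\<^sub>v | v :: 'v]\<close>: a monomial is an exponent vector \<open>'v \<Rightarrow>\<^sub>0 nat\<close>, and a
  polynomial maps monomials to their coefficients.
\<close>

type_synonym ('v, 'k) mpoly = "('v \<Rightarrow>\<^sub>0 nat) \<Rightarrow>\<^sub>0 'k"

definition var :: "'v \<Rightarrow> ('v, 'k::field) mpoly" where
  "var v = Poly_Mapping.single (Poly_Mapping.single v 1) 1"

definition monom_degree :: "('v::finite \<Rightarrow>\<^sub>0 nat) \<Rightarrow> nat" where
  "monom_degree m = (\<Sum>v\<in>UNIV. Poly_Mapping.lookup m v)"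

text \<open>The zero polynomial is homogeneous of every degree, and it is the only
  polynomial that is homogeneous of a given negative degree.\<close>

definition homogeneous :: "('v::finite, 'k::field) mpoly \<Rightarrow> int \<Rightarrow> bool" where
  "homogeneous p d \<longleftrightarrow> (\<forall>m \<in> Poly_Mapping.keys p. int (monom_degree m) = d)"

text \<open>The ideal generated by \<open>G\<close>, i.e. its span in the ring as a module over itself.\<close>

definition ideal_gen :: "'r::comm_ring_1 set \<Rightarrow> 'r set" where
  "ideal_gen G = module.span (*) G"

lemma module_self: "module ((*) :: 'r::comm_ring_1 \<Rightarrow> 'r \<Rightarrow> 'r)"
  by unfold_locales (simp_all add: algebra_simps)

section \<open>Minimal graded free resolutions and graded Betti numbers\<close>

text \<open>
  A complex \<open>\<dots> \<rightarrow> F\<^sub>2 \<rightarrow> F\<^sub>1 \<rightarrow> F\<^sub>0 \<rightarrow> S\<close> of graded free modules of finite rank, presented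
  by matrices with entries in \<open>S\<close> (the type \<open>'r\<close>).  Here \<open>F\<^sub>i\<close> is the direct sum of the
  \<open>S(-gshift R i c)\<close> for \<open>c < rnk R i\<close>, so that its \<open>c\<close>-th basis element has degree
  \<open>gshift R i c\<close>.  The augmentation sends the \<open>c\<close>-th basis element of \<open>F\<^sub>0\<close> to \<open>aug R c\<close>,
  and \<open>dif R i\<close> is the matrix of \<open>F\<^bsub>i+1\<^esub> \<rightarrow> F\<^sub>i\<close> (row index first).  Values outside these
  index ranges are irrelevant.
\<close>

record 'r graded_complex =
  rnk :: "nat \<Rightarrow> nat"
  gshift :: "nat \<Rightarrow> nat \<Rightarrow> int"
  aug :: "nat \<Rightarrow> 'r"
  dif :: "nat \<Rightarrow> nat \<Rightarrow> nat \<Rightarrow> 'r"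

definition aug_map ::
    "('v::finite, 'k::field) mpoly graded_complex \<Rightarrow> (nat \<Rightarrow> ('v, 'k) mpoly) \<Rightarrow> ('v, 'k) mpoly" where
  "aug_map R u = (\<Sum>c < rnk R 0. u c * aug R c)"

definition dif_map ::
    "('v::finite, 'k::field) mpoly graded_complex \<Rightarrow> nat \<Rightarrow> (nat \<Rightarrow> ('v, 'k) mpoly)
      \<Rightarrow> nat \<Rightarrow> ('v, 'k) mpoly" where
  "dif_map R i u a = (\<Sum>b < rnk R (Suc i). dif R i a b * u b)"

text \<open>All maps are homogeneous of degree 0, the image of \<open>F\<^sub>0 \<rightarrow> S\<close> is \<open>I\<close>, and the
  complex is exact at every \<open>F\<^sub>i\<close>.\<close>

definition graded_free_resolution ::
    "('v::finite, 'k::field) mpoly set \<Rightarrow> ('v, 'k) mpoly graded_complex \<Rightarrow> bool" where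
  "graded_free_resolution I R \<longleftrightarrow>
     (\<forall>c < rnk R 0. homogeneous (aug R c) (gshift R 0 c)) \<and>
     (\<forall>i. \<forall>a < rnk R i. \<forall>b < rnk R (Suc i).
        homogeneous (dif R i a b) (gshift R (Suc i) b - gshift R i a)) \<and>
     range (aug_map R) = I \<and>
     (\<forall>u. aug_map R u = 0 \<longleftrightarrow> (\<exists>v. \<forall>c < rnk R 0. u c = dif_map R 0 v c)) \<and>
     (\<forall>i u. (\<forall>a < rnk R i. dif_map R i u a = 0) \<longleftrightarrow>
        (\<exists>v. \<forall>b < rnk R (Suc i). u b = dif_map R (Suc i) v b))"

text \<open>Minimality: \<open>F\<^bsub>i+1\<^esub>\<close> is mapped into \<open>(x\<^sub>v | v) F\<^sub>i\<close>, i.e. all matrix entries have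
  constant coefficient 0.\<close>

definition minimal_graded_free_resolution ::
    "('v::finite, 'k::field) mpoly set \<Rightarrow> ('v, 'k) mpoly graded_complex \<Rightarrow> bool" where
  "minimal_graded_free_resolution I R \<longleftrightarrow> graded_free_resolution I R \<and>
     (\<forall>i. \<forall>a < rnk R i. \<forall>b < rnk R (Suc i). Poly_Mapping.lookup (dif R i a b) 0 = 0)"

text \<open>
  \<open>\<beta>\<^bsub>i,j\<^esub>(I)\<close> is the number of copies of \<open>S(-j)\<close> in the \<open>i\<close>-th module of a minimal graded
  free resolution of \<open>I\<close>.  Such a resolution exists for every homogeneous ideal and this
  number does not depend on it; other ideals have no such resolution, and the
  definition is only meant for homogeneous ones.
\<close>

definition betti :: "('v::finite, 'k::field) mpoly set \<Rightarrow> nat \<Rightarrow> int \<Rightarrow> nat" where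
  "betti I i j = (THE b. \<exists>R. minimal_graded_free_resolution I R \<and>
     b = card {c. c < rnk R i \<and> gshift R i c = j})"

definition proj_dim :: "('v::finite, 'k::field) mpoly set \<Rightarrow> nat" where
  "proj_dim I = Max {i. \<exists>j. betti I i j \<noteq> 0}"

definition regularity :: "('v::finite, 'k::field) mpoly set \<Rightarrow> int" where
  "regularity I = Max {j - int i | i j. betti I i j \<noteq> 0}"

section \<open>Vertex-weighted oriented graphs and their edge ideals\<close>

text \<open>
  The vertex set is the finite type \<open>'v\<close>, and \<open>(u, v) \<in> E\<close> is an edge directed from \<open>u\<close>
  to \<open>v\<close>.  The predicate \<open>asym E\<close> excludes loops as well as pairs of opposite edges.
\<close>

definition weighted_oriented_graph :: "('v::finite \<times> 'v) set \<Rightarrow> ('v \<Rightarrow> nat) \<Rightarrow> bool" where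
  "weighted_oriented_graph E w \<longleftrightarrow> asym E \<and> (\<forall>v. w v \<ge> 1)"

definition oriented_cycle :: "('v::finite \<times> 'v) set \<Rightarrow> bool" where
  "oriented_cycle E \<longleftrightarrow> (\<exists>xs. distinct xs \<and> set xs = UNIV \<and> length xs \<ge> 3 \<and>
     E = {(xs ! i, xs ! (Suc i mod length xs)) | i. i < length xs})"

definition edge_ideal :: "('v::finite \<times> 'v) set \<Rightarrow> ('v \<Rightarrow> nat) \<Rightarrow> ('v, 'k::field) mpoly set" where
  "edge_ideal E w = ideal_gen {var u * var v ^ w v | u v. (u, v) \<in> E}"

end

theory Submission
  imports Defs "HOL-Library.Function_Algebras"
begin

text \<open>
  The generators of \<open>I(D)\<close> are the monomials \<open>x\<^sub>u x\<^sub>v\<^sup>w\<close> for the edges \<open>uv\<close>, with \<open>w\<close> the weight of \<open>v\<close>.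
  Any family of monomials has a Taylor resolution: its basis elements in homological degree
  \<open>i\<close> are the sets \<open>A\<close> of \<open>i + 1\<close> generators, and \<open>A\<close> has the degree of the least
  common multiple of its members.  This resolution is minimal as soon as leaving out a
  generator always lowers the least common multiple.  On an oriented cycle with all
  weights at least 2 this is the case: the variable of a vertex \<open>v\<close> occurs with exponent
  \<open>w v \<ge> 2\<close> in the edge that ends in \<open>v\<close>, with exponent 1 in the edge that starts in \<open>v\<close>, and in no
  other edge.  Hence \<open>\<beta>\<^bsub>i,j\<^esub>\<close> is the number of sets of \<open>i + 1\<close> edges whose least common
  multiple has degree \<open>j\<close> (\<open>betti_taylor\<close>).

  The cardinalities of nonempty sets of edges run from 1 to the number of edges, which
  gives the projective dimension.  For the regularity one maximizes
  \<open>deg (lcm A) - \<bar>A\<bar> + 1\<close>.  Each edge that is missing from \<open>A\<close> lowers the exponent of its end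
  point by at least 1, so \<open>deg (lcm A) - \<bar>A\<bar>\<close> is largest when \<open>A\<close> consists of all edges, and then
  \<open>deg (lcm A)\<close> is the sum of all weights.

  Two general facts carry this.  The ranks and shifts in a minimal resolution depend only on
  the ideal, so that the Taylor resolution may be used to compute Betti numbers (\<open>betti_eq\<close>):
  comparison maps in both directions compose to a map that is homotopic to the identity, and
  equal to it modulo the variables.  And the Taylor complex is exact (\<open>taylor_exact\<close>):
  its part in a given multidegree is the chain complex of the full simplex on
  the generators that divide the corresponding monomial, and a simplex is contractible.
\<close>

section \<open>Coefficients and homogeneous parts of polynomials\<close>

lemma lookup_single_times:
  fixes p :: "('a::cancel_comm_monoid_add) \<Rightarrow>\<^sub>0 ('b::semiring_0)"
  shows "Poly_Mapping.lookup (Poly_Mapping.single c k * p) (c + m) = k * Poly_Mapping.lookup p m"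
    and "(\<And>d. m' \<noteq> c + d) \<Longrightarrow> Poly_Mapping.lookup (Poly_Mapping.single c k * p) m' = 0"
  by (simp_all add: lookup_mult lookup_single when_mult)

lemma lookup_times_zero:
  fixes p q :: "('v::finite, 'k::field) mpoly"
  shows "Poly_Mapping.lookup (p * q) 0 = Poly_Mapping.lookup p 0 * Poly_Mapping.lookup q 0"
proof -
  have 0: "0 = l + r \<longleftrightarrow> l = 0 \<and> r = 0" for l r :: "'v \<Rightarrow>\<^sub>0 nat"
    by (auto simp: poly_mapping_eq_iff fun_eq_iff lookup_add)
  have "(\<Sum>r. Poly_Mapping.lookup q r when 0 = l + r) = (Poly_Mapping.lookup q 0 when l = 0)"
    for l :: "'v \<Rightarrow>\<^sub>0 nat"
    by (cases "l = 0") (simp_all add: 0)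
  then show ?thesis
    by (simp add: lookup_mult mult_when)
qed

lemma monom_degree_add: "monom_degree (a + b) = monom_degree a + monom_degree b"
  by (simp add: monom_degree_def lookup_add sum.distrib)

lemma homogeneous_zero [simp]: "homogeneous 0 d"
  by (simp add: homogeneous_def)

lemma homogeneous_one: "homogeneous 1 0"
  by (auto simp: homogeneous_def monom_degree_def)

lemma homogeneous_times:
  assumes "homogeneous p d" "homogeneous q e"
  shows "homogeneous (p * q) (d + e)"
  using assms keys_mult[of p q] by (fastforce simp: homogeneous_def monom_degree_add)

lemma homogeneous_add: "homogeneous p d \<Longrightarrow> homogeneous q d \<Longrightarrow> homogeneous (p + q) d"
  using keys_add[of p q] by (auto simp: homogeneous_def)

lemma homogeneous_sum: "(\<And>a. a \<in> X \<Longrightarrow> homogeneous (f a) d) \<Longrightarrow> homogeneous (sum f X) d"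
  by (induction X rule: infinite_finite_induct) (auto intro: homogeneous_add)

definition homogeneous_part :: "int \<Rightarrow> ('v::finite, 'k::field) mpoly \<Rightarrow> ('v, 'k) mpoly" where
  "homogeneous_part d p = Poly_Mapping.mapp (\<lambda>m c. c when int (monom_degree m) = d) p"

lemma lookup_homogeneous_part:
  "Poly_Mapping.lookup (homogeneous_part d p) m = (Poly_Mapping.lookup p m when int (monom_degree m) = d)"
  by (simp add: homogeneous_part_def lookup_mapp when_def in_keys_iff)

lemma homogeneous_part_add: "homogeneous_part d (p + q) = homogeneous_part d p + homogeneous_part d q"
  by (rule poly_mapping_eqI) (simp add: lookup_homogeneous_part lookup_add when_add_distrib)

lemma homogeneous_part_sum: "homogeneous_part d (sum f X) = (\<Sum>a\<in>X. homogeneous_part d (f a))"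
  by (rule poly_mapping_eqI) (auto simp: lookup_homogeneous_part lookup_sum when_def)

lemma homogeneous_homogeneous_part: "homogeneous (homogeneous_part d p) d"
  by (auto simp: homogeneous_def in_keys_iff lookup_homogeneous_part)

lemma homogeneous_part_of_homogeneous: "homogeneous p d \<Longrightarrow> homogeneous_part d p = p"
  by (rule poly_mapping_eqI) (auto simp: homogeneous_def in_keys_iff lookup_homogeneous_part when_def)

text \<open>
  The terms of \<open>q\<close> outside degree \<open>d - e\<close> contribute nothing to the product in degree \<open>d\<close>.
\<close>

lemma homogeneous_part_times:
  assumes "homogeneous p e"
  shows "homogeneous_part d (p * q) = p * homogeneous_part (d - e) q"
proof -
  define r where "r = q - homogeneous_part (d - e) q"
  have r: "int (monom_degree m) \<noteq> d - e" if "m \<in> Poly_Mapping.keys r" for m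
    using that by (auto simp: r_def in_keys_iff lookup_minus lookup_homogeneous_part)
  have "int (monom_degree m) \<noteq> d" if "m \<in> Poly_Mapping.keys (p * r)" for m
  proof -
    from that keys_mult[of p r] obtain a b
      where "m = a + b" "a \<in> Poly_Mapping.keys p" "b \<in> Poly_Mapping.keys r" by blast
    then show ?thesis using r[of b] assms by (auto simp: homogeneous_def monom_degree_add)
  qed
  then have "homogeneous_part d (p * r) = 0"
    by (intro poly_mapping_eqI) (auto simp: lookup_homogeneous_part when_def in_keys_iff)
  moreover have "homogeneous (p * homogeneous_part (d - e) q) d"
    using homogeneous_times[OF assms homogeneous_homogeneous_part[of "d - e" q]] by simp
  moreover have "p * q = p * homogeneous_part (d - e) q + p * r"
    by (simp add: r_def algebra_simps)
  ultimately show ?thesis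
    by (simp add: homogeneous_part_add homogeneous_part_of_homogeneous)
qed

section \<open>Matrices indexed by natural numbers\<close>

text \<open>
  Matrices are total functions, and a product sums over an explicit number of inner indices.
  If every matrix vanishes outside its range, identities between maps of free modules become
  equations between functions, and associativity and distributivity hold without conditions
  on ranges.
\<close>

definition mat_mul :: "nat \<Rightarrow> (nat \<Rightarrow> nat \<Rightarrow> 'r::comm_ring_1) \<Rightarrow> (nat \<Rightarrow> nat \<Rightarrow> 'r) \<Rightarrow> nat \<Rightarrow> nat \<Rightarrow> 'r" where
  "mat_mul k X Y a b = (\<Sum>c<k. X a c * Y c b)"

definition mat_id :: "nat \<Rightarrow> nat \<Rightarrow> nat \<Rightarrow> 'r::comm_ring_1" where
  "mat_id k a b = (if a = b \<and> a < k then 1 else 0)"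

lemma mat_mul_assoc: "mat_mul l (mat_mul k X Y) Z = mat_mul k X (mat_mul l Y Z)"
  unfolding mat_mul_def fun_eq_iff
  by (auto simp: sum_distrib_left sum_distrib_right mult.assoc intro: sum.swap)

lemma mat_mul_diff_left: "mat_mul k (X - Y) Z = mat_mul k X Z - mat_mul k Y Z"
  by (simp add: mat_mul_def fun_eq_iff left_diff_distrib sum_subtractf)

lemma mat_mul_diff_right: "mat_mul k X (Y - Z) = mat_mul k X Y - mat_mul k X Z"
  by (simp add: mat_mul_def fun_eq_iff right_diff_distrib sum_subtractf)

lemma mat_mul_mat_id_left: "(\<And>a b. a \<ge> k \<Longrightarrow> X a b = 0) \<Longrightarrow> mat_mul k (mat_id k) X = X"
proof (intro ext)
  fix a b assume "\<And>a b. a \<ge> k \<Longrightarrow> X a b = 0"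
  have "mat_mul k (mat_id k) X a b = (\<Sum>c<k. if c = a then X a b else 0)"
    unfolding mat_mul_def by (rule sum.cong) (auto simp: mat_id_def)
  then show "mat_mul k (mat_id k) X a b = X a b" using \<open>\<And>a b. a \<ge> k \<Longrightarrow> X a b = 0\<close> by simp
qed

lemma mat_mul_mat_id_right: "(\<And>a b. b \<ge> k \<Longrightarrow> X a b = 0) \<Longrightarrow> mat_mul k X (mat_id k) = X"
proof (intro ext)
  fix a b assume *: "\<And>a b. b \<ge> k \<Longrightarrow> X a b = 0"
  have "mat_mul k X (mat_id k) a b = (\<Sum>c<k. if c = b then X a b else 0)"
    unfolding mat_mul_def by (rule sum.cong) (auto simp: mat_id_def)
  then show "mat_mul k X (mat_id k) a b = X a b" using * by simp
qed

lemma mat_mul_zero_left [simp]: "mat_mul k (\<lambda>a b. 0) Y = (\<lambda>a b. 0)"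
  by (simp add: mat_mul_def fun_eq_iff)

lemma mat_mul_zero_right [simp]: "mat_mul k X (\<lambda>a b. 0) = (\<lambda>a b. 0)"
  by (simp add: mat_mul_def fun_eq_iff)

text \<open>
  A matrix with a left inverse has at least as many rows as columns: the unit vectors
  of the space of functions on \<open>X\<close> lie in the span of the columns of \<open>B\<close>.
\<close>

lemma card_le_of_left_inverse:
  fixes B :: "'a \<Rightarrow> 'b \<Rightarrow> 'k::field"
  assumes X: "finite X" and Y: "finite Y"
    and inv: "\<And>a b. a \<in> X \<Longrightarrow> b \<in> X \<Longrightarrow> (\<Sum>c\<in>Y. B a c * C c b) = (if a = b then 1 else 0)"
  shows "card X \<le> card Y"
proof -
  define sc :: "'k \<Rightarrow> ('a \<Rightarrow> 'k) \<Rightarrow> 'a \<Rightarrow> 'k" where "sc = (\<lambda>k f a. k * f a)"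
  interpret vector_space sc
    by unfold_locales (auto simp: sc_def fun_eq_iff algebra_simps)
  define u where "u b = (\<lambda>a. if a = b then 1 else (0::'k))" for b :: 'a
  define col where "col c = (\<lambda>a. if a \<in> X then B a c else 0)" for c
  have inj: "inj_on u X"
    by (auto simp: inj_on_def u_def fun_eq_iff)
  have eval: "sum f Z a = (\<Sum>z\<in>Z. f z a)" for f :: "'c \<Rightarrow> 'a \<Rightarrow> 'k" and Z a
    by (induction Z rule: infinite_finite_induct) auto
  have "independent (u ` X)"
  proof (rule independent_if_scalars_zero)
    fix f x assume 0: "(\<Sum>x\<in>u ` X. sc (f x) x) = 0" and "x \<in> u ` X"
    then obtain b where b: "b \<in> X" "x = u b" by auto
    have "(\<Sum>x\<in>u ` X. sc (f x) x) b = (\<Sum>a\<in>X. sc (f (u a)) (u a) b)"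
      by (simp add: sum.reindex[OF inj] eval)
    also have "\<dots> = (\<Sum>a\<in>X. if a = b then f (u b) else 0)"
      by (rule sum.cong) (auto simp: sc_def u_def)
    also have "\<dots> = f x" using X b by simp
    finally show "f x = 0" using 0 by simp
  qed (use X in simp)
  moreover have "u ` X \<subseteq> span (col ` Y)"
  proof
    fix x assume "x \<in> u ` X"
    then obtain b where b: "b \<in> X" "x = u b" by auto
    have "x = (\<Sum>c\<in>Y. sc (C c b) (col c))"
    proof
      fix a
      show "x a = (\<Sum>c\<in>Y. sc (C c b) (col c)) a"
        using inv[of a b] b by (cases "a \<in> X") (auto simp: eval sc_def u_def col_def mult.commute)
    qed
    then show "x \<in> span (col ` Y)"
      by (auto intro: span_sum span_scale span_base)
  qed
  ultimately have "card (u ` X) \<le> card (col ` Y)"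
    using independent_span_bound[of "col ` Y" "u ` X"] Y by blast
  also have "\<dots> \<le> card Y" by (rule card_image_le[OF Y])
  finally show ?thesis by (simp add: card_image[OF inj])
qed

section \<open>Invariance of graded Betti numbers\<close>

text \<open>
  The augmented complex \<open>\<dots> \<rightarrow> F\<^sub>1 \<rightarrow> F\<^sub>0 \<rightarrow> S\<close>, with all positions shifted by one so
  that the augmentation is the differential number 0.  Then comparison maps and homotopies
  are built by one recursion that starts with the identity of \<open>S\<close>.
\<close>

definition aug_rank :: "('v::finite, 'k::field) mpoly graded_complex \<Rightarrow> nat \<Rightarrow> nat" where
  "aug_rank R i = (case i of 0 \<Rightarrow> 1 | Suc k \<Rightarrow> rnk R k)"

definition aug_shift :: "('v::finite, 'k::field) mpoly graded_complex \<Rightarrow> nat \<Rightarrow> nat \<Rightarrow> int" where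
  "aug_shift R i c = (case i of 0 \<Rightarrow> 0 | Suc k \<Rightarrow> gshift R k c)"

definition aug_dif :: "('v::finite, 'k::field) mpoly graded_complex \<Rightarrow> nat \<Rightarrow> nat \<Rightarrow> nat \<Rightarrow> ('v, 'k) mpoly" where
  "aug_dif R i a b = (if a < aug_rank R i \<and> b < aug_rank R (Suc i)
     then (case i of 0 \<Rightarrow> aug R b | Suc k \<Rightarrow> dif R k a b) else 0)"

lemma aug_rank_simps [simp]: "aug_rank R 0 = 1" "aug_rank R (Suc i) = rnk R i"
  by (simp_all add: aug_rank_def)

lemma aug_shift_simps [simp]: "aug_shift R 0 c = 0" "aug_shift R (Suc i) c = gshift R i c"
  by (simp_all add: aug_shift_def)

lemma aug_dif_simps:
  "b < rnk R 0 \<Longrightarrow> aug_dif R 0 0 b = aug R b"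
  "a < rnk R i \<Longrightarrow> b < rnk R (Suc i) \<Longrightarrow> aug_dif R (Suc i) a b = dif R i a b"
  by (simp_all add: aug_dif_def)

lemma aug_dif_outside: "a \<ge> aug_rank R i \<Longrightarrow> aug_dif R i a b = 0" "b \<ge> rnk R i \<Longrightarrow> aug_dif R i a b = 0"
  by (auto simp: aug_dif_def)

lemma homogeneous_aug_dif:
  assumes "graded_free_resolution I R"
  shows "homogeneous (aug_dif R i a b) (aug_shift R (Suc i) b - aug_shift R i a)"
  using assms by (cases i) (auto simp: graded_free_resolution_def aug_dif_def)

lemma minimal_aug_dif:
  assumes "minimal_graded_free_resolution I R"
  shows "Poly_Mapping.lookup (aug_dif R (Suc i) a b) 0 = 0"
  using assms by (auto simp: minimal_graded_free_resolution_def aug_dif_def)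

lemma aug_map_aug_dif: "aug_map R u = (\<Sum>b<rnk R 0. aug_dif R 0 0 b * u b)"
  unfolding aug_map_def by (rule sum.cong) (auto simp: aug_dif_simps mult.commute)

lemma dif_map_aug_dif: "a < rnk R i \<Longrightarrow> dif_map R i u a = (\<Sum>b<rnk R (Suc i). aug_dif R (Suc i) a b * u b)"
  unfolding dif_map_def by (rule sum.cong) (auto simp: aug_dif_simps)

lemma augmentation_range:
  assumes "graded_free_resolution I R"
  shows "y \<in> I \<longleftrightarrow> (\<exists>u. y = (\<Sum>b<rnk R 0. aug_dif R 0 0 b * u b))"
  using assms unfolding graded_free_resolution_def aug_map_aug_dif[symmetric] by (auto simp: image_iff)

lemma aug_dif_exact:
  assumes "graded_free_resolution I R"
  shows "(\<forall>a<aug_rank R i. (\<Sum>b<rnk R i. aug_dif R i a b * u b) = 0) \<longleftrightarrow>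
    (\<exists>v. \<forall>b<rnk R i. u b = (\<Sum>c<rnk R (Suc i). aug_dif R (Suc i) b c * v c))"
proof (cases i)
  case 0
  have "aug_map R u = 0 \<longleftrightarrow> (\<exists>v. \<forall>c < rnk R 0. u c = dif_map R 0 v c)"
    using assms by (simp add: graded_free_resolution_def)
  then show ?thesis using 0 by (simp add: aug_map_aug_dif dif_map_aug_dif)
next
  case (Suc k)
  have "(\<forall>a < rnk R k. dif_map R k u a = 0) \<longleftrightarrow>
        (\<exists>v. \<forall>b < rnk R (Suc k). u b = dif_map R (Suc k) v b)"
    using assms by (simp add: graded_free_resolution_def)
  then show ?thesis using Suc by (simp add: dif_map_aug_dif)
qed

lemma aug_dif_comp:
  assumes "graded_free_resolution I R"
  shows "mat_mul (rnk R i) (aug_dif R i) (aug_dif R (Suc i)) = (\<lambda>a b. 0)"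
proof (intro ext)
  fix a c
  show "mat_mul (rnk R i) (aug_dif R i) (aug_dif R (Suc i)) a c = 0"
  proof (cases "a < aug_rank R i \<and> c < rnk R (Suc i)")
    case True
    have "\<exists>v. \<forall>b<rnk R i. aug_dif R (Suc i) b c = (\<Sum>e<rnk R (Suc i). aug_dif R (Suc i) b e * v e)"
      by (rule exI[of _ "\<lambda>e. if e = c then 1 else 0"]) (use True in \<open>simp add: if_distrib cong: if_cong\<close>)
    then have "\<forall>a<aug_rank R i. (\<Sum>b<rnk R i. aug_dif R i a b * aug_dif R (Suc i) b c) = 0"
      using aug_dif_exact[OF assms, of i "\<lambda>b. aug_dif R (Suc i) b c"] by blast
    then show ?thesis using True by (simp add: mat_mul_def)
  qed (auto simp: mat_mul_def aug_dif_outside)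
qed

text \<open>
  A matrix is a family of columns, and exactness lifts each of them.
\<close>

lemma lift_through_aug_dif:
  assumes "graded_free_resolution I R"
    and zero: "mat_mul (rnk R i) (aug_dif R i) X = (\<lambda>a b. 0)"
    and rows: "\<And>a b. a \<ge> rnk R i \<Longrightarrow> X a b = 0"
  shows "\<exists>Y. X = mat_mul (rnk R (Suc i)) (aug_dif R (Suc i)) Y"
proof -
  have "\<exists>v. \<forall>a. X a b = (\<Sum>c<rnk R (Suc i). aug_dif R (Suc i) a c * v c)" for b
  proof -
    have "\<forall>a<aug_rank R i. (\<Sum>c<rnk R i. aug_dif R i a c * X c b) = 0"
      using zero by (simp add: mat_mul_def fun_eq_iff)
    then obtain v where v: "\<forall>a<rnk R i. X a b = (\<Sum>c<rnk R (Suc i). aug_dif R (Suc i) a c * v c)"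
      using aug_dif_exact[OF assms(1), of i "\<lambda>c. X c b"] by blast
    have "X a b = (\<Sum>c<rnk R (Suc i). aug_dif R (Suc i) a c * v c)" for a
      using v rows[of a b] by (cases "a < rnk R i") (auto simp: aug_dif_outside)
    then show ?thesis by blast
  qed
  then obtain V where "\<And>b a. X a b = (\<Sum>c<rnk R (Suc i). aug_dif R (Suc i) a c * V b c)"
    by metis
  then show ?thesis
    by (intro exI[of _ "\<lambda>c b. V b c"]) (simp add: mat_mul_def fun_eq_iff)
qed

text \<open>
  The differentials are homogeneous, so taking the homogeneous part of the right degree
  of each entry of a preimage gives a preimage again.
\<close>

lemma homogeneous_factor:
  assumes R: "graded_free_resolution I R"
    and X: "X = mat_mul (rnk R i) (aug_dif R i) Y"
    and hom: "\<And>a b. homogeneous (X a b) (s b - aug_shift R i a)"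
  shows "\<exists>Y. X = mat_mul (rnk R i) (aug_dif R i) Y \<and> (\<forall>a b. homogeneous (Y a b) (s b - gshift R i a))"
proof (intro exI[of _ "\<lambda>a b. homogeneous_part (s b - gshift R i a) (Y a b)"] conjI ext allI)
  fix a b
  have "X a b = homogeneous_part (s b - aug_shift R i a) (X a b)"
    by (simp add: homogeneous_part_of_homogeneous hom)
  also have "\<dots> = (\<Sum>c<rnk R i. homogeneous_part (s b - aug_shift R i a) (aug_dif R i a c * Y c b))"
    by (simp add: X mat_mul_def homogeneous_part_sum)
  also have "\<dots> = (\<Sum>c<rnk R i. aug_dif R i a c * homogeneous_part (s b - gshift R i c) (Y c b))"
    by (intro sum.cong refl) (simp add: homogeneous_part_times[OF homogeneous_aug_dif[OF R]])
  finally show "X a b = mat_mul (rnk R i) (aug_dif R i) (\<lambda>a b. homogeneous_part (s b - gshift R i a) (Y a b)) a b"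
    by (simp add: mat_mul_def)
qed (rule homogeneous_homogeneous_part)

text \<open>
  The comparison theorem: the identity of \<open>S\<close> lifts step by step.  At the bottom, a
  generator of \<open>I\<close> is in the image of the other augmentation; above it, the
  composite to be lifted consists of cycles because the map one step below commutes with
  the differentials.
\<close>

lemma chain_map_exists:
  assumes F: "graded_free_resolution I F" and G: "graded_free_resolution I G"
  shows "\<exists>\<phi>. \<phi> 0 = mat_id 1 \<and>
    (\<forall>i. mat_mul (aug_rank F i) (\<phi> i) (aug_dif F i) = mat_mul (rnk G i) (aug_dif G i) (\<phi> (Suc i))) \<and>
    (\<forall>i a b. homogeneous (\<phi> i a b) (aug_shift F i b - aug_shift G i a))"
proof -
  define P where "P i f \<longleftrightarrow> (i = 0 \<longrightarrow> f = mat_id 1) \<and>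
      (\<forall>a b. homogeneous (f a b) (aug_shift F i b - aug_shift G i a)) \<and>
      (\<exists>Y. mat_mul (aug_rank F i) f (aug_dif F i) = mat_mul (rnk G i) (aug_dif G i) Y)" for i f
  define Q where "Q i f f' \<longleftrightarrow> mat_mul (aug_rank F i) f (aug_dif F i) = mat_mul (rnk G i) (aug_dif G i) f'" for i f f'
  have base: "P 0 (mat_id 1)"
  proof -
    have "\<exists>v. aug F b = (\<Sum>c<rnk G 0. aug_dif G 0 0 c * v c)" if "b < rnk F 0" for b
    proof -
      have "aug F b \<in> I"
        unfolding augmentation_range[OF F]
        by (rule exI[of _ "\<lambda>c. if c = b then 1 else 0"])
          (use that in \<open>simp add: if_distrib aug_dif_simps cong: if_cong\<close>)
      then show ?thesis by (simp add: augmentation_range[OF G])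
    qed
    then obtain V where V: "\<And>b. b < rnk F 0 \<Longrightarrow> aug F b = (\<Sum>c<rnk G 0. aug_dif G 0 0 c * V b c)"
      by metis
    have "mat_mul 1 (mat_id 1) (aug_dif F 0) = mat_mul (rnk G 0) (aug_dif G 0) (\<lambda>c b. if b < rnk F 0 then V b c else 0)"
    proof (subst mat_mul_mat_id_left)
      show "aug_dif F 0 = mat_mul (rnk G 0) (aug_dif G 0) (\<lambda>c b. if b < rnk F 0 then V b c else 0)"
      proof (intro ext)
        fix a b
        show "aug_dif F 0 a b = mat_mul (rnk G 0) (aug_dif G 0) (\<lambda>c b. if b < rnk F 0 then V b c else 0) a b"
          by (cases "a = 0"; cases "b < rnk F 0") (auto simp: mat_mul_def aug_dif_simps aug_dif_outside V)
      qed
    qed (auto simp: aug_dif_outside)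
    then show ?thesis
      by (auto simp: P_def mat_id_def homogeneous_one)
  qed
  have step: "\<exists>f'. P (Suc i) f' \<and> Q i f f'" if Pf: "P i f" for i f
  proof -
    from Pf obtain Y where Y: "mat_mul (aug_rank F i) f (aug_dif F i) = mat_mul (rnk G i) (aug_dif G i) Y"
      and hom: "\<And>a b. homogeneous (f a b) (aug_shift F i b - aug_shift G i a)"
      by (auto simp: P_def)
    have "homogeneous (mat_mul (aug_rank F i) f (aug_dif F i) a b) (gshift F i b - aug_shift G i a)" for a b
      unfolding mat_mul_def
    proof (rule homogeneous_sum)
      fix c
      show "homogeneous (f a c * aug_dif F i c b) (gshift F i b - aug_shift G i a)"
        using homogeneous_times[OF hom[of a c] homogeneous_aug_dif[OF F, of i c b]] by simp
    qed
    then obtain f0 where f0: "mat_mul (aug_rank F i) f (aug_dif F i) = mat_mul (rnk G i) (aug_dif G i) f0"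
      and f0h: "\<And>a b. homogeneous (f0 a b) (gshift F i b - gshift G i a)"
      using homogeneous_factor[OF G Y, of "gshift F i"] by blast
    define f' where "f' = (\<lambda>a b. if a < rnk G i then f0 a b else 0)"
    have Q: "Q i f f'"
      unfolding Q_def f0 by (simp add: mat_mul_def f'_def fun_eq_iff)
    have "mat_mul (rnk G i) (aug_dif G i) (mat_mul (rnk F i) f' (aug_dif F (Suc i))) =
        mat_mul (aug_rank F i) f (mat_mul (rnk F i) (aug_dif F i) (aug_dif F (Suc i)))"
      using Q by (simp add: Q_def flip: mat_mul_assoc)
    also have "\<dots> = (\<lambda>a b. 0)"
      by (simp add: aug_dif_comp[OF F])
    finally have "\<exists>Y. mat_mul (rnk F i) f' (aug_dif F (Suc i)) = mat_mul (rnk G (Suc i)) (aug_dif G (Suc i)) Y"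
      by (rule lift_through_aug_dif[OF G]) (simp add: mat_mul_def f'_def)
    then have "P (Suc i) f'"
      using f0h by (auto simp: P_def f'_def)
    with Q show ?thesis by blast
  qed
  obtain \<phi> where "\<forall>i. P i (\<phi> i) \<and> Q i (\<phi> i) (\<phi> (Suc i))"
    using dependent_nat_choice[of P Q] base step by metis
  then show ?thesis by (auto simp: P_def Q_def)
qed


text \<open>
  A chain endomorphism over the identity of \<open>S\<close> is homotopic to the identity.  The
  recursion keeps the invariant that what the homotopy has not yet accounted for is killed
  by the differential, hence is a boundary.
\<close>

lemma homotopy_exists:
  assumes F: "graded_free_resolution I F"
    and rows: "\<And>i a b. a \<ge> aug_rank F i \<Longrightarrow> \<alpha> i a b = 0"
    and zero: "\<alpha> 0 = mat_id 1"
    and chain: "\<And>i. mat_mul (aug_rank F i) (\<alpha> i) (aug_dif F i) = mat_mul (rnk F i) (aug_dif F i) (\<alpha> (Suc i))"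
  shows "\<exists>h. h 0 = (\<lambda>a b. 0) \<and>
    (\<forall>i. \<alpha> (Suc i) - mat_id (rnk F i) - mat_mul (aug_rank F i) (h i) (aug_dif F i)
       = mat_mul (rnk F (Suc i)) (aug_dif F (Suc i)) (h (Suc i)))"
proof -
  define D where "D i h = \<alpha> (Suc i) - mat_id (rnk F i) - mat_mul (aug_rank F i) h (aug_dif F i)" for i h
  define P where "P i h \<longleftrightarrow> (i = 0 \<longrightarrow> h = (\<lambda>a b. 0)) \<and> (\<forall>a b. a \<ge> rnk F i \<longrightarrow> h a b = 0) \<and>
    mat_mul (rnk F i) (aug_dif F i) (D i h) = (\<lambda>a b. 0)" for i h
  define Q where "Q i h h' \<longleftrightarrow> D i h = mat_mul (rnk F (Suc i)) (aug_dif F (Suc i)) h'" for i h h'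
  have aug_dif_mat_id: "mat_mul (rnk F i) (aug_dif F i) (mat_id (rnk F i)) = aug_dif F i" for i
    by (rule mat_mul_mat_id_right) (simp add: aug_dif_outside)
  have mat_id_aug_dif: "mat_mul (aug_rank F i) (mat_id (aug_rank F i)) (aug_dif F i) = aug_dif F i" for i
    by (rule mat_mul_mat_id_left) (simp add: aug_dif_outside)
  have base: "P 0 (\<lambda>a b. 0)"
    using chain[of 0] mat_id_aug_dif[of 0]
    by (simp add: P_def D_def mat_mul_diff_right zero aug_dif_mat_id) (simp add: fun_eq_iff)
  have step: "\<exists>h'. P (Suc i) h' \<and> Q i h h'" if P: "P i h" for i h
  proof -
    have "D i h a b = 0" if "a \<ge> rnk F i" for a b
      using P that rows[of "Suc i" a b] by (simp add: D_def P_def mat_id_def mat_mul_def)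
    then obtain h0 where h0: "D i h = mat_mul (rnk F (Suc i)) (aug_dif F (Suc i)) h0"
      using lift_through_aug_dif[OF F] P unfolding P_def by blast
    define h' where "h' = (\<lambda>a b. if a < rnk F (Suc i) then h0 a b else 0)"
    have Q: "Q i h h'"
      unfolding Q_def h0 by (simp add: mat_mul_def h'_def fun_eq_iff)
    have "mat_mul (rnk F (Suc i)) (aug_dif F (Suc i)) (mat_mul (rnk F i) h' (aug_dif F (Suc i)))
        = mat_mul (rnk F i) (D i h) (aug_dif F (Suc i))"
      using Q by (simp add: Q_def flip: mat_mul_assoc)
    also have "\<dots> = mat_mul (rnk F i) (\<alpha> (Suc i)) (aug_dif F (Suc i)) - aug_dif F (Suc i)
        - mat_mul (aug_rank F i) h (mat_mul (rnk F i) (aug_dif F i) (aug_dif F (Suc i)))"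
      using mat_id_aug_dif[of "Suc i"] by (simp add: D_def mat_mul_diff_left mat_mul_assoc)
    also have "\<dots> = mat_mul (rnk F (Suc i)) (aug_dif F (Suc i)) (\<alpha> (Suc (Suc i))) - aug_dif F (Suc i)"
      using chain[of "Suc i"] by (simp add: aug_dif_comp[OF F]) (simp add: fun_eq_iff)
    finally have "mat_mul (rnk F (Suc i)) (aug_dif F (Suc i)) (D (Suc i) h') = (\<lambda>a b. 0)"
      by (simp add: D_def mat_mul_diff_right aug_dif_mat_id) (simp add: fun_eq_iff)
    then have "P (Suc i) h'"
      by (simp add: P_def h'_def)
    with Q show ?thesis by blast
  qed
  obtain h where "\<forall>i. P i (h i) \<and> Q i (h i) (h (Suc i))"
    using dependent_nat_choice[of P Q] base step by metis
  then show ?thesis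
    unfolding P_def Q_def D_def by blast
qed

definition const_part :: "(nat \<Rightarrow> nat \<Rightarrow> ('v::finite, 'k::field) mpoly) \<Rightarrow> nat \<Rightarrow> nat \<Rightarrow> 'k" where
  "const_part X a b = Poly_Mapping.lookup (X a b) 0"

text \<open>
  Let \<open>\<phi> : F \<rightarrow> G\<close> and \<open>\<psi> : G \<rightarrow> F\<close> be comparison maps.  Both terms of the homotopy
  between \<open>\<psi> \<circ> \<phi>\<close> and the identity have a differential of \<open>F\<close> as a factor, or a homotopy
  that is 0; by minimality their constant parts vanish.  So the constant part of
  \<open>\<psi>\<close> is a left inverse of that of \<open>\<phi>\<close>.  As \<open>\<phi>\<close> is homogeneous, its constant part only relates basis elements of the same
  degree, and the ranks can be compared degree by degree.
\<close>

lemma minimal_resolution_card_le: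
  assumes F: "minimal_graded_free_resolution I F" and G: "minimal_graded_free_resolution I G"
  shows "card {c. c < rnk F i \<and> gshift F i c = j} \<le> card {c. c < rnk G i \<and> gshift G i c = j}"
proof -
  have F': "graded_free_resolution I F" and G': "graded_free_resolution I G"
    using F G by (simp_all add: minimal_graded_free_resolution_def)
  obtain \<phi> where \<phi>0: "\<phi> 0 = mat_id 1"
    and \<phi>: "\<And>i. mat_mul (aug_rank F i) (\<phi> i) (aug_dif F i) = mat_mul (rnk G i) (aug_dif G i) (\<phi> (Suc i))"
    and \<phi>_hom: "\<And>i a b. homogeneous (\<phi> i a b) (aug_shift F i b - aug_shift G i a)"
    using chain_map_exists[OF F' G'] by blast
  obtain \<psi> where \<psi>0: "\<psi> 0 = mat_id 1"
    and \<psi>: "\<And>i. mat_mul (aug_rank G i) (\<psi> i) (aug_dif G i) = mat_mul (rnk F i) (aug_dif F i) (\<psi> (Suc i))"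
    using chain_map_exists[OF G' F'] by blast
  define \<alpha> where "\<alpha> i = (\<lambda>a b. if a < aug_rank F i then mat_mul (aug_rank G i) (\<psi> i) (\<phi> i) a b else 0)" for i
  have "\<exists>h. h 0 = (\<lambda>a b. 0) \<and>
    (\<forall>i. \<alpha> (Suc i) - mat_id (rnk F i) - mat_mul (aug_rank F i) (h i) (aug_dif F i)
       = mat_mul (rnk F (Suc i)) (aug_dif F (Suc i)) (h (Suc i)))"
  proof (rule homotopy_exists[OF F'])
    show "\<alpha> 0 = mat_id 1"
      by (simp add: \<alpha>_def \<phi>0 \<psi>0 fun_eq_iff mat_mul_def mat_id_def)
    fix i
    have "mat_mul (aug_rank F i) (\<alpha> i) (aug_dif F i)
        = (\<lambda>a b. if a < aug_rank F i then mat_mul (aug_rank F i) (mat_mul (aug_rank G i) (\<psi> i) (\<phi> i)) (aug_dif F i) a b else 0)"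
      by (simp add: \<alpha>_def mat_mul_def fun_eq_iff)
    also have "mat_mul (aug_rank F i) (mat_mul (aug_rank G i) (\<psi> i) (\<phi> i)) (aug_dif F i)
        = mat_mul (rnk F i) (aug_dif F i) (mat_mul (rnk G i) (\<psi> (Suc i)) (\<phi> (Suc i)))"
      by (simp add: mat_mul_assoc \<phi>) (simp add: \<psi> flip: mat_mul_assoc)
    also have "(\<lambda>a b. if a < aug_rank F i then mat_mul (rnk F i) (aug_dif F i) (mat_mul (rnk G i) (\<psi> (Suc i)) (\<phi> (Suc i))) a b else 0)
        = mat_mul (rnk F i) (aug_dif F i) (\<alpha> (Suc i))"
      by (simp add: \<alpha>_def mat_mul_def fun_eq_iff aug_dif_outside)
    finally show "mat_mul (aug_rank F i) (\<alpha> i) (aug_dif F i) = mat_mul (rnk F i) (aug_dif F i) (\<alpha> (Suc i))" .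
  qed (simp add: \<alpha>_def)
  then obtain h where h0: "h 0 = (\<lambda>a b. 0)"
    and h: "\<And>i. \<alpha> (Suc i) - mat_id (rnk F i) - mat_mul (aug_rank F i) (h i) (aug_dif F i)
       = mat_mul (rnk F (Suc i)) (aug_dif F (Suc i)) (h (Suc i))" by blast
  have inv: "(\<Sum>c<rnk G i. const_part (\<psi> (Suc i)) a c * const_part (\<phi> (Suc i)) c b) = (if a = b then 1 else 0)"
    if "a < rnk F i" for a b
  proof -
    have *: "\<alpha> (Suc i) a b = mat_id (rnk F i) a b + mat_mul (aug_rank F i) (h i) (aug_dif F i) a b
        + mat_mul (rnk F (Suc i)) (aug_dif F (Suc i)) (h (Suc i)) a b"
      using fun_cong[OF fun_cong[OF h[of i]], of a b] by (simp add: algebra_simps)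
    have "const_part (mat_mul (rnk F (Suc i)) (aug_dif F (Suc i)) (h (Suc i))) a b = 0"
      by (simp add: const_part_def mat_mul_def lookup_sum lookup_times_zero minimal_aug_dif[OF F])
    moreover have "const_part (mat_mul (aug_rank F i) (h i) (aug_dif F i)) a b = 0"
      \<comment> \<open>For i = 0 the differential is the augmentation, which minimality does not control; there the homotopy is 0.\<close>
      by (cases i) (simp_all add: const_part_def mat_mul_def lookup_sum lookup_times_zero minimal_aug_dif[OF F] h0)
    moreover have "const_part (mat_id (rnk F i) :: _ \<Rightarrow> _ \<Rightarrow> ('a, 'b) mpoly) a b = (if a = b then 1 else 0)"
      using that by (simp add: const_part_def mat_id_def)
    ultimately have "const_part (\<alpha> (Suc i)) a b = (if a = b then 1 else 0)"
      unfolding const_part_def * lookup_add by simp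
    then show ?thesis
      using that by (simp add: const_part_def \<alpha>_def mat_mul_def lookup_sum lookup_times_zero)
  qed
  show ?thesis
  proof (rule card_le_of_left_inverse)
    fix a b assume a: "a \<in> {c. c < rnk F i \<and> gshift F i c = j}" and b: "b \<in> {c. c < rnk F i \<and> gshift F i c = j}"
    have "const_part (\<phi> (Suc i)) c b = 0" if "gshift G i c \<noteq> j" for c
    proof (rule ccontr)
      assume "const_part (\<phi> (Suc i)) c b \<noteq> 0"
      then have "gshift F i b = gshift G i c"
        using \<phi>_hom[of "Suc i" c b] by (auto simp: homogeneous_def const_part_def in_keys_iff monom_degree_def dest!: bspec[where x = 0])
      then show False using that b by simp
    qed
    then have "(\<Sum>c\<in>{c. c < rnk G i \<and> gshift G i c = j}. const_part (\<psi> (Suc i)) a c * const_part (\<phi> (Suc i)) c b)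
       = (\<Sum>c<rnk G i. const_part (\<psi> (Suc i)) a c * const_part (\<phi> (Suc i)) c b)"
      by (intro sum.mono_neutral_left) auto
    then show "(\<Sum>c\<in>{c. c < rnk G i \<and> gshift G i c = j}. const_part (\<psi> (Suc i)) a c * const_part (\<phi> (Suc i)) c b)
       = (if a = b then 1 else 0)"
      using inv a by simp
  qed auto
qed

lemma betti_eq:
  assumes "minimal_graded_free_resolution I R"
  shows "betti I i j = card {c. c < rnk R i \<and> gshift R i c = j}"
  unfolding betti_def
  by (rule the_equality) (use assms in \<open>auto intro!: antisym minimal_resolution_card_le\<close>)

section \<open>Least common multiples of monomials\<close>

text \<open>
  Divisibility of the monomials with these exponent vectors.
\<close>

definition exp_le :: "('v \<Rightarrow>\<^sub>0 nat) \<Rightarrow> ('v \<Rightarrow>\<^sub>0 nat) \<Rightarrow> bool" where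
  "exp_le a b \<longleftrightarrow> (\<forall>v. Poly_Mapping.lookup a v \<le> Poly_Mapping.lookup b v)"

lemma exp_le_add: "exp_le a (a + b)"
  by (simp add: exp_le_def lookup_add)

lemma exp_le_add_diff: "exp_le a b \<Longrightarrow> a + (b - a) = b"
  by (rule poly_mapping_eqI) (simp add: exp_le_def lookup_add lookup_minus)

lemma exp_le_diff_add_diff: "exp_le a b \<Longrightarrow> exp_le b c \<Longrightarrow> (b - a) + (c - b) = c - a"
  by (rule poly_mapping_eqI) (simp add: exp_le_def lookup_add lookup_minus)

lemma monom_degree_diff: "exp_le a b \<Longrightarrow> int (monom_degree (b - a)) = int (monom_degree b) - int (monom_degree a)"
  using monom_degree_add[of a "b - a"] by (simp add: exp_le_add_diff)

definition exp_lcm :: "(nat \<Rightarrow> ('v::finite \<Rightarrow>\<^sub>0 nat)) \<Rightarrow> nat set \<Rightarrow> ('v \<Rightarrow>\<^sub>0 nat)" where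
  "exp_lcm m A = Abs_poly_mapping (\<lambda>v. Max (insert 0 ((\<lambda>a. Poly_Mapping.lookup (m a) v) ` A)))"

lemma lookup_exp_lcm:
  "Poly_Mapping.lookup (exp_lcm m A) v = Max (insert 0 ((\<lambda>a. Poly_Mapping.lookup (m a) v) ` A))"
  unfolding exp_lcm_def by (subst lookup_Abs_poly_mapping) auto

lemma lookup_exp_lcm_le:
  "finite A \<Longrightarrow> Poly_Mapping.lookup (exp_lcm m A) v \<le> k \<longleftrightarrow> (\<forall>a\<in>A. Poly_Mapping.lookup (m a) v \<le> k)"
  by (simp add: lookup_exp_lcm)

lemma exp_lcm_le: "finite A \<Longrightarrow> exp_le (exp_lcm m A) b \<longleftrightarrow> (\<forall>a\<in>A. exp_le (m a) b)"
  by (auto simp: exp_le_def lookup_exp_lcm_le)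

lemma exp_le_exp_lcm_member: "finite A \<Longrightarrow> a \<in> A \<Longrightarrow> exp_le (m a) (exp_lcm m A)"
  using exp_lcm_le[of A m "exp_lcm m A"] by (simp add: exp_le_def)

lemma exp_lcm_mono: "finite B \<Longrightarrow> A \<subseteq> B \<Longrightarrow> exp_le (exp_lcm m A) (exp_lcm m B)"
  using exp_lcm_le[of A m "exp_lcm m B"] by (auto intro: exp_le_exp_lcm_member finite_subset)

lemma exp_lcm_empty [simp]: "exp_lcm m {} = 0"
  by (rule poly_mapping_eqI) (simp add: lookup_exp_lcm)

lemma exp_lcm_singleton [simp]: "exp_lcm m {a} = m a"
  by (rule poly_mapping_eqI) (simp add: lookup_exp_lcm)

section \<open>The contractibility of a simplex\<close>

text \<open>
  The sign with which \<open>A\<close> occurs in the boundary of \<open>insert a A\<close>.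
\<close>

definition insertion_sign :: "nat \<Rightarrow> nat set \<Rightarrow> 'k::comm_ring_1" where
  "insertion_sign a A = (-1) ^ card {b \<in> A. b < a}"

lemma insertion_sign_insert:
  assumes "finite A" "b \<notin> A"
  shows "insertion_sign a (insert b A) = (if b < a then - insertion_sign a A else insertion_sign a A)"
proof -
  have "{c \<in> insert b A. c < a} = (if b < a then insert b {c \<in> A. c < a} else {c \<in> A. c < a})"
    by auto
  then show ?thesis using assms by (simp add: insertion_sign_def)
qed

lemma insertion_sign_least: "(\<And>b. b \<in> A \<Longrightarrow> a \<le> b) \<Longrightarrow> insertion_sign a A = 1"
proof -
  assume "\<And>b. b \<in> A \<Longrightarrow> a \<le> b"
  then have "{b \<in> A. b < a} = {}" by fastforce
  then show "insertion_sign a A = 1" by (simp only: insertion_sign_def card.empty power_0)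
qed

text \<open>
  The cancellation that makes a boundary of a boundary vanish; in this form it also
  covers characteristic 2.
\<close>

lemma sum_alternating_pairs:
  fixes f :: "'a \<Rightarrow> 'a \<Rightarrow> 'b::ab_group_add"
  assumes "finite X" "\<And>a b. a \<in> X \<Longrightarrow> b \<in> X \<Longrightarrow> a \<noteq> b \<Longrightarrow> f b a = - f a b"
  shows "(\<Sum>a\<in>X. \<Sum>b\<in>X - {a}. f a b) = 0"
  using assms
proof (induction X)
  case (insert x X)
  have "(\<Sum>b\<in>insert x X - {a}. f a b) = f a x + (\<Sum>b\<in>X - {a}. f a b)" if "a \<in> X" for a
  proof -
    have "insert x X - {a} = insert x (X - {a})" using that insert.hyps by auto
    then show ?thesis using insert.hyps by simp
  qed
  then have "(\<Sum>a\<in>X. \<Sum>b\<in>insert x X - {a}. f a b) = (\<Sum>a\<in>X. f a x) + (\<Sum>a\<in>X. \<Sum>b\<in>X - {a}. f a b)"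
    by (simp add: sum.distrib)
  moreover have "(\<Sum>a\<in>X. f a x) = - (\<Sum>b\<in>X. f x b)"
  proof -
    have "(\<Sum>a\<in>X. f a x) = (\<Sum>a\<in>X. - f x a)"
      by (intro sum.cong refl insert.prems) (use insert.hyps in auto)
    then show ?thesis by (simp add: sum_negf)
  qed
  moreover have "insert x X - {x} = X" using insert.hyps by auto
  moreover have "(\<Sum>a\<in>X. \<Sum>b\<in>X - {a}. f a b) = 0"
    by (rule insert.IH) (use insert.prems in blast)
  ultimately show ?case using insert.hyps by simp
qed simp

text \<open>
  Adding the least vertex \<open>p\<close> contracts the chain complex of the full simplex on \<open>K\<close>.
  Here \<open>c\<close> gives the coefficients of a chain, and the sum on the right is the coefficient at \<open>A\<close>
  of the boundary of the cone over \<open>c\<close> with apex \<open>p\<close>.  If \<open>p \<notin> A\<close>, only \<open>a = p\<close> contributes.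
  If \<open>p \<in> A\<close>, the sum is \<open>c A\<close> minus the coefficient of the boundary of \<open>c\<close> at \<open>A - {p}\<close>,
  because leaving out the smallest vertex flips every sign; and that coefficient is 0.
\<close>

lemma simplex_contraction:
  fixes c :: "nat set \<Rightarrow> 'k::comm_ring_1"
  assumes K: "finite K" and p: "p \<in> K" "\<And>q. q \<in> K \<Longrightarrow> p \<le> q" and A: "A \<subseteq> K"
    and cycle: "p \<in> A \<Longrightarrow> (\<Sum>a\<in>K - (A - {p}). insertion_sign a (A - {p}) * c (insert a (A - {p}))) = 0"
  shows "c A = (\<Sum>a\<in>K - A. insertion_sign a A * (if p \<in> insert a A then c (insert a A - {p}) else 0))"
proof (cases "p \<in> A")
  case False
  have "(\<Sum>a\<in>K - A. insertion_sign a A * (if p \<in> insert a A then c (insert a A - {p}) else 0))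
      = (\<Sum>a\<in>K - A. if a = p then c A else 0)"
    by (intro sum.cong) (use False p A in \<open>auto simp: insertion_sign_least subset_iff\<close>)
  then show ?thesis using False p K by simp
next
  case True
  have fin: "finite (A - {p})" using K A finite_subset by blast
  have A_eq: "A = insert p (A - {p})" using True by auto
  have "insertion_sign a A * c (insert a A - {p}) = - (insertion_sign a (A - {p}) * c (insert a (A - {p})))"
    if "a \<in> K - A" for a
  proof -
    have "p < a" using p(2)[of a] that True by (metis Diff_iff le_neq_implies_less)
    then have "insertion_sign a A = (- insertion_sign a (A - {p}) :: 'k)"
      using insertion_sign_insert[OF fin, of p a] A_eq by simp
    moreover have "insert a A - {p} = insert a (A - {p})" using \<open>p < a\<close> by auto
    ultimately show ?thesis by simp
  qed
  then have "(\<Sum>a\<in>K - A. insertion_sign a A * (if p \<in> insert a A then c (insert a A - {p}) else 0))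
      = - (\<Sum>a\<in>K - A. insertion_sign a (A - {p}) * c (insert a (A - {p})))"
    using True by (simp add: sum_negf)
  moreover have "K - (A - {p}) = insert p (K - A)" using p True by auto
  moreover have "insertion_sign p (A - {p}) = (1::'k)" by (rule insertion_sign_least) (use p A in auto)
  ultimately show ?thesis
    using cycle[OF True] K True by (simp add: insert_absorb add_eq_0_iff2)
qed

section \<open>The Taylor resolution of a monomial ideal\<close>

text \<open>
  The Taylor differential on families indexed by sets of generators, in all homological
  degrees at once: the value at \<open>A\<close> collects the contributions of the sets with one more
  element.
\<close>

definition taylor_dif ::
  "nat \<Rightarrow> (nat \<Rightarrow> ('v::finite \<Rightarrow>\<^sub>0 nat)) \<Rightarrow> (nat set \<Rightarrow> ('v, 'k::field) mpoly) \<Rightarrow> nat set \<Rightarrow> ('v, 'k) mpoly" where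
  "taylor_dif n m U A = (\<Sum>a\<in>{..<n} - A.
     Poly_Mapping.single (exp_lcm m (insert a A) - exp_lcm m A) (insertion_sign a A) * U (insert a A))"

lemma taylor_dif_comp:
  assumes "finite A"
  shows "taylor_dif n m (taylor_dif n m V) A = 0"
proof -
  define f where "f a b = Poly_Mapping.single (exp_lcm m (insert a (insert b A)) - exp_lcm m A)
    (insertion_sign a A * insertion_sign b (insert a A)) * V (insert a (insert b A))" for a b
  have "taylor_dif n m (taylor_dif n m V) A = (\<Sum>a\<in>{..<n} - A. \<Sum>b\<in>{..<n} - A - {a}. f a b)"
    unfolding taylor_dif_def sum_distrib_left
  proof (intro sum.cong)
    fix a b assume "a \<in> {..<n} - A" "b \<in> {..<n} - A - {a}"
    have "exp_le (exp_lcm m A) (exp_lcm m (insert a A))"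
      "exp_le (exp_lcm m (insert a A)) (exp_lcm m (insert b (insert a A)))"
      using assms by (auto intro: exp_lcm_mono)
    then show "Poly_Mapping.single (exp_lcm m (insert a A) - exp_lcm m A) (insertion_sign a A) *
        (Poly_Mapping.single (exp_lcm m (insert b (insert a A)) - exp_lcm m (insert a A)) (insertion_sign b (insert a A)) *
         V (insert b (insert a A))) = f a b"
      by (simp add: f_def exp_le_diff_add_diff insert_commute mult_single flip: mult.assoc)
  qed auto
  also have "\<dots> = 0"
  proof (rule sum_alternating_pairs)
    fix a b assume ab: "a \<in> {..<n} - A" "b \<in> {..<n} - A" "a \<noteq> b"
    then have "insertion_sign b A * insertion_sign a (insert b A) = - (insertion_sign a A * insertion_sign b (insert a A) :: 'b)"
      using assms by (auto simp: insertion_sign_insert)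
    then show "f b a = - f a b"
      by (simp add: f_def insert_commute single_uminus)
  qed simp
  finally show ?thesis .
qed

text \<open>
  The component of multidegree \<open>\<alpha>\<close>.  The basis element of \<open>A\<close> has the multidegree of the
  least common multiple, so its coefficient contributes a scalar, and none at all if
  \<open>A\<close> contains a generator that does not divide the monomial \<open>\<alpha>\<close>.
\<close>

definition coeff_at ::
  "(nat \<Rightarrow> ('v::finite \<Rightarrow>\<^sub>0 nat)) \<Rightarrow> (nat set \<Rightarrow> ('v, 'k::field) mpoly) \<Rightarrow> ('v \<Rightarrow>\<^sub>0 nat) \<Rightarrow> nat set \<Rightarrow> 'k" where
  "coeff_at m U \<alpha> A = (if exp_le (exp_lcm m A) \<alpha> then Poly_Mapping.lookup (U A) (\<alpha> - exp_lcm m A) else 0)"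

lemma lookup_eq_coeff_at: "Poly_Mapping.lookup (U A) \<mu> = coeff_at m U (exp_lcm m A + \<mu>) A"
  by (simp add: coeff_at_def exp_le_add)

text \<open>
  In multidegree \<open>\<alpha>\<close> the Taylor differential is the boundary of the full simplex whose
  vertices are the generators that divide \<open>\<alpha>\<close>.
\<close>

lemma coeff_at_taylor_dif:
  assumes "finite A" and le: "exp_le (exp_lcm m A) \<alpha>"
  shows "coeff_at m (taylor_dif n m U) \<alpha> A = (\<Sum>a\<in>{a. a < n \<and> exp_le (m a) \<alpha>} - A. insertion_sign a A * coeff_at m U \<alpha> (insert a A))"
proof -
  have "coeff_at m (taylor_dif n m U) \<alpha> A = (\<Sum>a\<in>{..<n} - A. insertion_sign a A * coeff_at m U \<alpha> (insert a A))"
    unfolding coeff_at_def[of m "taylor_dif n m U"] if_P[OF le] taylor_dif_def lookup_sum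
  proof (rule sum.cong)
    fix a
    let ?B = "insert a A" let ?c = "exp_lcm m ?B - exp_lcm m A"
    have AB: "exp_le (exp_lcm m A) (exp_lcm m ?B)" using assms by (auto intro: exp_lcm_mono)
    show "Poly_Mapping.lookup (Poly_Mapping.single ?c (insertion_sign a A) * U ?B) (\<alpha> - exp_lcm m A)
        = insertion_sign a A * coeff_at m U \<alpha> ?B"
    proof (cases "exp_le (exp_lcm m ?B) \<alpha>")
      case True
      then have "\<alpha> - exp_lcm m A = ?c + (\<alpha> - exp_lcm m ?B)" using AB by (simp add: exp_le_diff_add_diff)
      then show ?thesis using True by (simp add: coeff_at_def lookup_single_times(1))
    next
      case False
      have "\<alpha> - exp_lcm m A \<noteq> ?c + d" for d
      proof
        assume "\<alpha> - exp_lcm m A = ?c + d"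
        then have "\<alpha> = exp_lcm m A + ?c + d" using exp_le_add_diff[OF le] by (metis add.assoc)
        then have "\<alpha> = exp_lcm m ?B + d" by (simp only: exp_le_add_diff[OF AB])
        then show False using False by (simp add: exp_le_add)
      qed
      then show ?thesis using False by (simp add: coeff_at_def lookup_single_times(2))
    qed
  qed simp
  also have "\<dots> = (\<Sum>a\<in>{a. a < n \<and> exp_le (m a) \<alpha>} - A. insertion_sign a A * coeff_at m U \<alpha> (insert a A))"
  proof (rule sum.mono_neutral_right)
    show "\<forall>a\<in>{..<n} - A - ({a. a < n \<and> exp_le (m a) \<alpha>} - A). insertion_sign a A * coeff_at m U \<alpha> (insert a A) = 0"
      using assms by (auto simp: coeff_at_def exp_lcm_le)
  qed auto
  finally show ?thesis .
qed

text \<open>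
  The contraction of the simplex, applied in every multidegree separately.  The apex \<open>p\<close>
  depends on the multidegree, so this map is in general not \<open>S\<close>-linear.
\<close>

definition taylor_contraction ::
  "nat \<Rightarrow> (nat \<Rightarrow> ('v::finite \<Rightarrow>\<^sub>0 nat)) \<Rightarrow> (nat set \<Rightarrow> ('v, 'k::field) mpoly) \<Rightarrow> nat set \<Rightarrow> ('v, 'k) mpoly" where
  "taylor_contraction n m U B = Abs_poly_mapping (\<lambda>\<mu>.
     let p = Min {a. a < n \<and> exp_le (m a) (exp_lcm m B + \<mu>)}
     in if p \<in> B then coeff_at m U (exp_lcm m B + \<mu>) (B - {p}) else 0)"

text \<open>
  There are only finitely many nonzero coefficients: each one comes from a monomial
  of one of the finitely many polynomials \<open>U (B - {p})\<close>, translated by a fixed vector.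
\<close>

lemma lookup_taylor_contraction:
  assumes B: "finite B"
  shows "Poly_Mapping.lookup (taylor_contraction n m U B) \<mu> =
     (let p = Min {a. a < n \<and> exp_le (m a) (exp_lcm m B + \<mu>)}
      in if p \<in> B then coeff_at m U (exp_lcm m B + \<mu>) (B - {p}) else 0)"
proof -
  have "finite (\<Union>p\<in>B. (\<lambda>\<mu>. \<mu> + (exp_lcm m B - exp_lcm m (B - {p}))) -` Poly_Mapping.keys (U (B - {p})))"
    using B by (intro finite_UN_I finite_vimageI) (auto simp: inj_def)
  moreover have "\<mu> \<in> (\<Union>p\<in>B. (\<lambda>\<mu>. \<mu> + (exp_lcm m B - exp_lcm m (B - {p}))) -` Poly_Mapping.keys (U (B - {p})))"
    if "p \<in> B" "coeff_at m U (exp_lcm m B + \<mu>) (B - {p}) \<noteq> 0" for p \<mu>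
  proof -
    have "exp_le (exp_lcm m (B - {p})) (exp_lcm m B)" using B by (auto intro: exp_lcm_mono)
    then have "exp_lcm m B + \<mu> - exp_lcm m (B - {p}) = \<mu> + (exp_lcm m B - exp_lcm m (B - {p}))"
      by (intro poly_mapping_eqI) (simp add: exp_le_def lookup_add lookup_minus)
    then have "\<mu> + (exp_lcm m B - exp_lcm m (B - {p})) \<in> Poly_Mapping.keys (U (B - {p}))"
      using that(2) by (auto simp: coeff_at_def in_keys_iff split: if_splits)
    then show ?thesis using that(1) by auto
  qed
  then have "{\<mu>. (let p = Min {a. a < n \<and> exp_le (m a) (exp_lcm m B + \<mu>)}
      in if p \<in> B then coeff_at m U (exp_lcm m B + \<mu>) (B - {p}) else 0) \<noteq> 0}
     \<subseteq> (\<Union>p\<in>B. (\<lambda>\<mu>. \<mu> + (exp_lcm m B - exp_lcm m (B - {p}))) -` Poly_Mapping.keys (U (B - {p})))"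
    by (auto simp only: Let_def split: if_splits)
  ultimately show ?thesis
    unfolding taylor_contraction_def using finite_subset by (subst lookup_Abs_poly_mapping) blast+
qed

lemma coeff_at_taylor_contraction:
  assumes "finite B" "exp_le (exp_lcm m B) \<alpha>"
  shows "coeff_at m (taylor_contraction n m U) \<alpha> B =
     (let p = Min {a. a < n \<and> exp_le (m a) \<alpha>} in if p \<in> B then coeff_at m U \<alpha> (B - {p}) else 0)"
  using assms by (simp add: coeff_at_def[of m "taylor_contraction n m U"] lookup_taylor_contraction exp_le_add_diff Let_def)

text \<open>
  Boundaries are cycles by the cancellation of signs.  Conversely, at a nonempty set \<open>A\<close> the
  simplex of every relevant multidegree contains \<open>A\<close>, so it has a least vertex and the
  contraction applies.
\<close>

lemma taylor_exact:
  fixes U :: "nat set \<Rightarrow> ('v::finite, 'k::field) mpoly"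
  shows "(\<forall>A\<subseteq>{..<n}. card A = i \<longrightarrow> taylor_dif n m U A = 0) \<longleftrightarrow>
    (\<exists>V. \<forall>A\<subseteq>{..<n}. card A = Suc i \<longrightarrow> U A = taylor_dif n m V A)"
proof
  assume "\<exists>V. \<forall>A\<subseteq>{..<n}. card A = Suc i \<longrightarrow> U A = taylor_dif n m V A"
  then obtain V where V: "\<And>A. A \<subseteq> {..<n} \<Longrightarrow> card A = Suc i \<Longrightarrow> U A = taylor_dif n m V A" by blast
  show "\<forall>A\<subseteq>{..<n}. card A = i \<longrightarrow> taylor_dif n m U A = 0"
  proof (intro allI impI)
    fix A :: "nat set" assume A: "A \<subseteq> {..<n}" "card A = i"
    then have fin: "finite A" using finite_subset by blast
    have "U (insert a A) = taylor_dif n m V (insert a A)" if "a \<in> {..<n} - A" for a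
      using that A fin by (intro V) auto
    then have "taylor_dif n m U A = taylor_dif n m (taylor_dif n m V) A"
      by (simp add: taylor_dif_def[of n m _ A])
    then show "taylor_dif n m U A = 0" by (simp add: taylor_dif_comp fin)
  qed
next
  assume U: "\<forall>A\<subseteq>{..<n}. card A = i \<longrightarrow> taylor_dif n m U A = 0"
  have "U A = taylor_dif n m (taylor_contraction n m U) A" if A: "A \<subseteq> {..<n}" "card A = Suc i" for A
  proof (rule poly_mapping_eqI)
    fix \<mu>
    define \<alpha> where "\<alpha> = exp_lcm m A + \<mu>"
    define K where "K = {a. a < n \<and> exp_le (m a) \<alpha>}"
    define p where "p = Min K"
    have fin: "finite A" using A finite_subset by blast
    have le: "exp_le (exp_lcm m A) \<alpha>" by (simp add: \<alpha>_def exp_le_add)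
    have K: "finite K" "A \<subseteq> K" using A(1) le fin by (auto simp: K_def exp_lcm_le)
    have "K \<noteq> {}" using A(2) K by auto
    then have p: "p \<in> K" "\<And>q. q \<in> K \<Longrightarrow> p \<le> q" using K by (auto simp: p_def)
    have "coeff_at m U \<alpha> A = (\<Sum>a\<in>K - A. insertion_sign a A *
        (if p \<in> insert a A then coeff_at m U \<alpha> (insert a A - {p}) else 0))"
    proof (rule simplex_contraction)
      assume "p \<in> A"
      have "exp_le (exp_lcm m (A - {p})) \<alpha>" using le fin by (auto simp: exp_lcm_le)
      moreover have "taylor_dif n m U (A - {p}) = 0"
        using A \<open>p \<in> A\<close> fin by (intro U[rule_format]) auto
      then have "coeff_at m (taylor_dif n m U) \<alpha> (A - {p}) = 0"
        by (simp add: coeff_at_def)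
      ultimately show "(\<Sum>a\<in>K - (A - {p}). insertion_sign a (A - {p}) * coeff_at m U \<alpha> (insert a (A - {p}))) = 0"
        using fin by (subst (asm) coeff_at_taylor_dif) (auto simp: K_def)
    qed (use K p in auto)
    also have "\<dots> = (\<Sum>a\<in>K - A. insertion_sign a A * coeff_at m (taylor_contraction n m U) \<alpha> (insert a A))"
    proof (rule sum.cong)
      fix a assume "a \<in> K - A"
      then have "exp_le (exp_lcm m (insert a A)) \<alpha>" using le fin by (auto simp: exp_lcm_le K_def)
      then show "insertion_sign a A * (if p \<in> insert a A then coeff_at m U \<alpha> (insert a A - {p}) else 0)
        = insertion_sign a A * coeff_at m (taylor_contraction n m U) \<alpha> (insert a A)"
        using fin by (simp add: coeff_at_taylor_contraction Let_def p_def K_def)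
    qed simp
    also have "\<dots> = coeff_at m (taylor_dif n m (taylor_contraction n m U)) \<alpha> A"
      using fin le by (simp add: coeff_at_taylor_dif K_def)
    finally show "Poly_Mapping.lookup (U A) \<mu> = Poly_Mapping.lookup (taylor_dif n m (taylor_contraction n m U) A) \<mu>"
      by (simp add: lookup_eq_coeff_at[of _ _ _ m] \<alpha>_def)
  qed
  then show "\<exists>V. \<forall>A\<subseteq>{..<n}. card A = Suc i \<longrightarrow> U A = taylor_dif n m V A" by blast
qed

text \<open>
  The basis in homological degree \<open>i\<close>.
\<close>

definition layer :: "nat \<Rightarrow> nat \<Rightarrow> nat set set" where
  "layer n i = {A. A \<subseteq> {..<n} \<and> card A = Suc i}"

definition enum_layer :: "nat \<Rightarrow> nat \<Rightarrow> nat \<Rightarrow> nat set" where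
  "enum_layer n i = (SOME f. bij_betw f {..<card (layer n i)} (layer n i))"

lemma finite_layer [simp]: "finite (layer n i)"
  by (rule finite_subset[of _ "Pow {..<n}"]) (auto simp: layer_def)

lemma bij_enum_layer: "bij_betw (enum_layer n i) {..<card (layer n i)} (layer n i)"
  unfolding enum_layer_def
  using ex_bij_betw_nat_finite[of "layer n i"] by (metis atLeast0LessThan finite_layer someI_ex)

lemma enum_layer_mem:
  assumes "c < card (layer n i)"
  shows "enum_layer n i c \<subseteq> {..<n}" "card (enum_layer n i c) = Suc i" "finite (enum_layer n i c)"
proof -
  have "enum_layer n i c \<in> layer n i" using bij_betw_apply[OF bij_enum_layer] assms by simp
  then show "enum_layer n i c \<subseteq> {..<n}" "card (enum_layer n i c) = Suc i" by (auto simp: layer_def)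
  then show "finite (enum_layer n i c)" using finite_subset by blast
qed

text \<open>
  The entries of interest are those where \<open>B\<close> has exactly one more element than \<open>A\<close>, and then
  \<open>the_elem\<close> returns this element.
\<close>

definition taylor_entry :: "(nat \<Rightarrow> ('v::finite \<Rightarrow>\<^sub>0 nat)) \<Rightarrow> nat set \<Rightarrow> nat set \<Rightarrow> ('v, 'k::field) mpoly" where
  "taylor_entry m A B =
     (if A \<subseteq> B then Poly_Mapping.single (exp_lcm m B - exp_lcm m A) (insertion_sign (the_elem (B - A)) A) else 0)"

definition taylor :: "nat \<Rightarrow> (nat \<Rightarrow> ('v::finite \<Rightarrow>\<^sub>0 nat)) \<Rightarrow> ('v, 'k::field) mpoly graded_complex" where
  "taylor n m = \<lparr>
     rnk = (\<lambda>i. card (layer n i)),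
     gshift = (\<lambda>i c. int (monom_degree (exp_lcm m (enum_layer n i c)))),
     aug = (\<lambda>c. taylor_entry m {} (enum_layer n 0 c)),
     dif = (\<lambda>i a b. taylor_entry m (enum_layer n i a) (enum_layer n (Suc i) b))\<rparr>"

lemma taylor_sel [simp]:
  "rnk (taylor n m) i = card (layer n i)"
  "gshift (taylor n m) i c = int (monom_degree (exp_lcm m (enum_layer n i c)))"
  "aug (taylor n m) c = taylor_entry m {} (enum_layer n 0 c)"
  "dif (taylor n m) i a b = taylor_entry m (enum_layer n i a) (enum_layer n (Suc i) b)"
  by (simp_all add: taylor_def)

text \<open>
  A vector, read as a family indexed by the sets that number its coordinates.
\<close>

definition on_sets :: "nat \<Rightarrow> nat \<Rightarrow> (nat \<Rightarrow> 'r) \<Rightarrow> nat set \<Rightarrow> 'r" where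
  "on_sets n i u A = u (inv_into {..<card (layer n i)} (enum_layer n i) A)"

lemma on_sets_enum: "c < card (layer n i) \<Longrightarrow> on_sets n i u (enum_layer n i c) = u c"
  unfolding on_sets_def
  using inv_into_f_f[OF bij_betw_imp_inj_on[OF bij_enum_layer]] by (metis lessThan_iff)

lemma all_layer_iff:
  "(\<forall>A\<subseteq>{..<n}. card A = Suc i \<longrightarrow> P A) \<longleftrightarrow> (\<forall>c<card (layer n i). P (enum_layer n i c))"
proof -
  have "(\<forall>A\<in>enum_layer n i ` {..<card (layer n i)}. P A) \<longleftrightarrow> (\<forall>c<card (layer n i). P (enum_layer n i c))"
    by auto
  then show ?thesis
    unfolding bij_betw_imp_surj_on[OF bij_enum_layer] by (auto simp: layer_def)
qed

text \<open>
  The sets in the layer above \<open>A\<close> that contain \<open>A\<close> are those that arise by inserting one element;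
  so the matrices of the numbered bases give the differential on families.
\<close>

lemma sum_taylor_entry:
  fixes u :: "nat \<Rightarrow> ('v::finite, 'k::field) mpoly"
  assumes A: "A \<subseteq> {..<n}" "card A = i"
  shows "(\<Sum>b<card (layer n i). taylor_entry m A (enum_layer n i b) * u b) = taylor_dif n m (on_sets n i u) A"
proof -
  have fin: "finite A" using A finite_subset by blast
  have "(\<Sum>b<card (layer n i). taylor_entry m A (enum_layer n i b) * u b)
      = (\<Sum>b<card (layer n i). taylor_entry m A (enum_layer n i b) * on_sets n i u (enum_layer n i b))"
    by (rule sum.cong) (auto simp: on_sets_enum)
  also have "\<dots> = (\<Sum>B\<in>layer n i. taylor_entry m A B * on_sets n i u B)"
    by (rule sum.reindex_bij_betw[OF bij_enum_layer])
  also have "\<dots> = (\<Sum>B\<in>(\<lambda>a. insert a A) ` ({..<n} - A). taylor_entry m A B * on_sets n i u B)"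
  proof (rule sum.mono_neutral_right)
    show "(\<lambda>a. insert a A) ` ({..<n} - A) \<subseteq> layer n i"
      using A fin by (auto simp: layer_def)
    show "\<forall>B\<in>layer n i - (\<lambda>a. insert a A) ` ({..<n} - A). taylor_entry m A B * on_sets n i u B = 0"
    proof
      fix B assume B: "B \<in> layer n i - (\<lambda>a. insert a A) ` ({..<n} - A)"
      have "\<not> A \<subseteq> B"
      proof
        assume AB: "A \<subseteq> B"
        then have "card (B - A) = 1"
          using B A fin by (subst card_Diff_subset) (auto simp: layer_def)
        then obtain a where "B - A = {a}" by (auto simp: card_1_singleton_iff)
        then have "B = insert a A" "a \<in> {..<n} - A" using AB B by (auto simp: layer_def)
        then show False using B by blast
      qed
      then show "taylor_entry m A B * on_sets n i u B = 0" by (simp add: taylor_entry_def)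
    qed
  qed simp
  also have "\<dots> = (\<Sum>a\<in>{..<n} - A. taylor_entry m A (insert a A) * on_sets n i u (insert a A))"
    by (rule sum.reindex_cong) (auto simp: inj_on_def)
  also have "\<dots> = taylor_dif n m (on_sets n i u) A"
    unfolding taylor_dif_def
  proof (rule sum.cong)
    fix a assume "a \<in> {..<n} - A"
    then have "insert a A - A = {a}" by auto
    then show "taylor_entry m A (insert a A) * on_sets n i u (insert a A)
        = Poly_Mapping.single (exp_lcm m (insert a A) - exp_lcm m A) (insertion_sign a A) * on_sets n i u (insert a A)"
      by (auto simp: taylor_entry_def)
  qed simp
  finally show ?thesis .
qed

lemma aug_map_taylor: "aug_map (taylor n m) u = taylor_dif n m (on_sets n 0 u) {}"
  using sum_taylor_entry[of "{}" n 0 m u] by (simp add: aug_map_def mult.commute)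

lemma dif_map_taylor:
  "a < card (layer n i) \<Longrightarrow> dif_map (taylor n m) i u a = taylor_dif n m (on_sets n (Suc i) u) (enum_layer n i a)"
  using sum_taylor_entry[of "enum_layer n i a" n "Suc i" m u] by (simp add: dif_map_def enum_layer_mem)

lemma taylor_dif_cong:
  assumes "\<And>B. B \<subseteq> {..<n} \<Longrightarrow> card B = Suc i \<Longrightarrow> U B = V B" and "A \<subseteq> {..<n}" "card A = i"
  shows "taylor_dif n m U A = taylor_dif n m V A"
proof -
  have "finite A" using assms finite_subset by blast
  then show ?thesis unfolding taylor_dif_def by (intro sum.cong) (auto simp: assms)
qed

lemma on_sets_surj: "\<exists>u. \<forall>B\<subseteq>{..<n}. card B = Suc i \<longrightarrow> on_sets n i u B = V B"
  by (rule exI[of _ "\<lambda>c. V (enum_layer n i c)"]) (simp add: all_layer_iff on_sets_enum)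

lemma ex_taylor_dif_iff:
  "(\<exists>V. \<forall>A\<subseteq>{..<n}. card A = Suc i \<longrightarrow> on_sets n i u A = taylor_dif n m V A) \<longleftrightarrow>
   (\<exists>v. \<forall>c<card (layer n i). u c = dif_map (taylor n m) i v c)" (is "?L \<longleftrightarrow> ?R")
proof
  assume ?L
  then obtain V where V: "\<forall>A\<subseteq>{..<n}. card A = Suc i \<longrightarrow> on_sets n i u A = taylor_dif n m V A" by blast
  obtain v where v: "\<forall>B\<subseteq>{..<n}. card B = Suc (Suc i) \<longrightarrow> on_sets n (Suc i) v B = V B"
    using on_sets_surj by blast
  have "taylor_dif n m V A = taylor_dif n m (on_sets n (Suc i) v) A" if "A \<subseteq> {..<n}" "card A = Suc i" for A
    using that v by (intro taylor_dif_cong) auto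
  then have "\<forall>c<card (layer n i). u c = dif_map (taylor n m) i v c"
    using V by (simp add: all_layer_iff on_sets_enum dif_map_taylor enum_layer_mem)
  then show ?R by blast
next
  assume ?R
  then show ?L by (auto simp: all_layer_iff on_sets_enum dif_map_taylor)
qed

lemma taylor_dif_empty: "taylor_dif n m U {} = (\<Sum>a<n. Poly_Mapping.single (m a) 1 * U {a})"
  by (simp add: taylor_dif_def insertion_sign_def)

lemma range_aug_map_taylor:
  fixes m :: "nat \<Rightarrow> ('v::finite \<Rightarrow>\<^sub>0 nat)"
  shows "range (aug_map (taylor n m)) = ideal_gen {Poly_Mapping.single (m a) (1::'k::field) | a. a < n}"
proof -
  interpret module "(*) :: ('v, 'k) mpoly \<Rightarrow> _ \<Rightarrow> _" by (rule module_self)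
  let ?G = "{Poly_Mapping.single (m a) (1::'k) | a. a < n}"
  have aug: "aug_map (taylor n m) u = (\<Sum>a<n. on_sets n 0 u {a} * Poly_Mapping.single (m a) (1::'k))" for u
    by (simp add: aug_map_taylor taylor_dif_empty mult.commute)
  show ?thesis
    unfolding ideal_gen_def
  proof (intro subset_antisym subsetI)
    fix y assume "y \<in> range (aug_map (taylor n m :: ('v, 'k) mpoly graded_complex))"
    then show "y \<in> span ?G"
      by (auto simp: aug intro!: span_sum span_scale intro: span_base)
  next
    fix y assume "y \<in> span ?G"
    then have "\<exists>g. y = (\<Sum>a<n. g a * Poly_Mapping.single (m a) (1::'k))"
    proof (induction rule: span_induct_alt)
      case base
      show ?case by (rule exI[of _ "\<lambda>_. 0"]) simp
    next
      case (step c x y)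
      then obtain g a where g: "y = (\<Sum>a<n. g a * Poly_Mapping.single (m a) (1::'k))"
        and a: "a < n" "x = Poly_Mapping.single (m a) 1" by blast
      have "c * x = (\<Sum>b<n. (if b = a then c else 0) * Poly_Mapping.single (m b) (1::'k))"
        using a by (simp add: if_distrib[of "\<lambda>t. t * _"] cong: if_cong)
      then have "c * x + y = (\<Sum>b<n. ((if b = a then c else 0) + g b) * Poly_Mapping.single (m b) (1::'k))"
        by (simp add: g distrib_right sum.distrib)
      then show ?case by (rule exI[of _ "\<lambda>b. (if b = a then c else 0) + g b"])
    qed
    then obtain g where g: "y = (\<Sum>a<n. g a * Poly_Mapping.single (m a) (1::'k))" by blast
    obtain u where "\<forall>B\<subseteq>{..<n}. card B = Suc 0 \<longrightarrow> on_sets n 0 u B = g (the_elem B)"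
      using on_sets_surj[of n 0 "\<lambda>B. g (the_elem B)"] by blast
    then have "y = aug_map (taylor n m) u"
      by (simp add: g aug)
    then show "y \<in> range (aug_map (taylor n m))" by blast
  qed
qed

lemma homogeneous_taylor_entry:
  "finite B \<Longrightarrow> homogeneous (taylor_entry m A B) (int (monom_degree (exp_lcm m B)) - int (monom_degree (exp_lcm m A)))"
  by (simp add: taylor_entry_def homogeneous_def monom_degree_diff exp_lcm_mono)

text \<open>
  The number 0 layer maps to \<open>S\<close> by the same formula as the others, with the empty set as the index of the
  basis element of \<open>S\<close>; this is why exactness at every position, including the first one,
  is an instance of the exactness on families.
\<close>

theorem taylor_resolution:
  fixes m :: "nat \<Rightarrow> ('v::finite \<Rightarrow>\<^sub>0 nat)"
  shows "graded_free_resolution (ideal_gen {Poly_Mapping.single (m a) (1::'k::field) | a. a < n}) (taylor n m)"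
    (is "graded_free_resolution _ ?T")
  unfolding graded_free_resolution_def
proof (intro conjI allI impI)
  fix c assume "c < rnk ?T 0"
  then show "homogeneous (aug ?T c) (gshift ?T 0 c)"
    using homogeneous_taylor_entry[of "enum_layer n 0 c" m "{}"] by (simp add: enum_layer_mem monom_degree_def)
next
  fix u
  show "aug_map ?T u = 0 \<longleftrightarrow> (\<exists>v. \<forall>c<rnk ?T 0. u c = dif_map ?T 0 v c)"
    using taylor_exact[of n 0 m "on_sets n 0 u"] unfolding ex_taylor_dif_iff
    by (auto simp: aug_map_taylor card_eq_0_iff dest: finite_subset)
next
  fix i u
  show "(\<forall>a<rnk ?T i. dif_map ?T i u a = 0) \<longleftrightarrow> (\<exists>v. \<forall>b<rnk ?T (Suc i). u b = dif_map ?T (Suc i) v b)"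
    using taylor_exact[of n "Suc i" m "on_sets n (Suc i) u"] unfolding ex_taylor_dif_iff
    by (simp add: all_layer_iff dif_map_taylor)
qed (auto intro: homogeneous_taylor_entry simp: enum_layer_mem range_aug_map_taylor)

text \<open>
  The entry at \<open>A \<subset> B\<close> is a monomial whose exponent is the quotient of the two least common
  multiples; the hypothesis keeps it from being a constant.
\<close>

lemma taylor_minimal:
  fixes m :: "nat \<Rightarrow> ('v::finite \<Rightarrow>\<^sub>0 nat)"
  assumes "\<And>A a. A \<subseteq> {..<n} \<Longrightarrow> a \<in> {..<n} - A \<Longrightarrow> \<not> exp_le (m a) (exp_lcm m A)"
  shows "minimal_graded_free_resolution
    (ideal_gen {Poly_Mapping.single (m a) (1::'k::field) | a. a < n}) (taylor n m)"
    (is "minimal_graded_free_resolution _ ?T")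
  unfolding minimal_graded_free_resolution_def
proof (intro conjI allI impI taylor_resolution)
  fix i a b
  let ?A = "enum_layer n i a" and ?B = "enum_layer n (Suc i) b"
  assume "a < rnk ?T i" "b < rnk ?T (Suc i)"
  then have A: "?A \<subseteq> {..<n}" "card ?A = Suc i" and B: "?B \<subseteq> {..<n}" "card ?B = Suc (Suc i)" "finite ?B"
    by (simp_all add: enum_layer_mem)
  have "exp_lcm m ?B - exp_lcm m ?A \<noteq> 0" if "?A \<subseteq> ?B"
  proof
    assume "exp_lcm m ?B - exp_lcm m ?A = 0"
    then have eq: "exp_lcm m ?B = exp_lcm m ?A"
      using exp_le_add_diff[OF exp_lcm_mono[OF B(3) that]] by (metis add.right_neutral)
    have "?A \<noteq> ?B" using A B by auto
    then obtain e where "e \<in> ?B - ?A" using \<open>?A \<subseteq> ?B\<close> by blast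
    then show False using assms[OF A(1), of e] exp_le_exp_lcm_member[OF B(3), of e m] B eq by auto
  qed
  then show "Poly_Mapping.lookup (dif ?T i a b) 0 = 0"
    by (simp add: taylor_entry_def lookup_single_not_eq)
qed

lemma betti_taylor:
  fixes m :: "nat \<Rightarrow> ('v::finite \<Rightarrow>\<^sub>0 nat)"
  assumes "\<And>A a. A \<subseteq> {..<n} \<Longrightarrow> a \<in> {..<n} - A \<Longrightarrow> \<not> exp_le (m a) (exp_lcm m A)"
  shows "betti (ideal_gen {Poly_Mapping.single (m a) (1::'k::field) | a. a < n}) i j
    = card {A. A \<subseteq> {..<n} \<and> card A = Suc i \<and> int (monom_degree (exp_lcm m A)) = j}"
proof -
  let ?C = "{c. c < card (layer n i) \<and> int (monom_degree (exp_lcm m (enum_layer n i c))) = j}"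
  have "card {A. A \<subseteq> {..<n} \<and> card A = Suc i \<and> int (monom_degree (exp_lcm m A)) = j} = card (enum_layer n i ` ?C)"
  proof (intro arg_cong[where f = card] subset_antisym subsetI)
    fix A assume A: "A \<in> {A. A \<subseteq> {..<n} \<and> card A = Suc i \<and> int (monom_degree (exp_lcm m A)) = j}"
    then have "A \<in> enum_layer n i ` {..<card (layer n i)}"
      unfolding bij_betw_imp_surj_on[OF bij_enum_layer] by (simp add: layer_def)
    then show "A \<in> enum_layer n i ` ?C" using A by auto
  qed (auto simp: enum_layer_mem(2) dest: subsetD[OF enum_layer_mem(1)])
  also have "\<dots> = card ?C"
    by (rule card_image) (rule inj_on_subset[OF bij_betw_imp_inj_on[OF bij_enum_layer]], auto)
  finally show ?thesis
    using betti_eq[OF taylor_minimal[where m = m and n = n and 'k = 'k], of i j] assms by simp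
qed

section \<open>Edge ideals of oriented cycles\<close>

lemma var_power: "var v ^ k = Poly_Mapping.single (Poly_Mapping.single v k) (1::'k::field)"
  by (induction k) (simp_all add: var_def mult_single flip: single_add)

definition cycle_exponent :: "'v list \<Rightarrow> ('v \<Rightarrow> nat) \<Rightarrow> nat \<Rightarrow> ('v \<Rightarrow>\<^sub>0 nat)" where
  "cycle_exponent xs w i = Poly_Mapping.single (xs ! i) 1
     + Poly_Mapping.single (xs ! (Suc i mod length xs)) (w (xs ! (Suc i mod length xs)))"

lemma edge_ideal_cycle:
  assumes "E = {(xs ! i, xs ! (Suc i mod length xs)) | i. i < length xs}"
  shows "(edge_ideal E w :: ('v::finite, 'k::field) mpoly set)
    = ideal_gen {Poly_Mapping.single (cycle_exponent xs w i) 1 | i. i < length xs}"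
proof -
  have "{var u * var v ^ w v | u v. (u, v) \<in> E}
      = {Poly_Mapping.single (cycle_exponent xs w i) (1::'k) | i. i < length xs}"
    unfolding assms by (auto simp: cycle_exponent_def var_power mult_single) (auto simp: var_def mult_single)
  then show ?thesis by (simp add: edge_ideal_def)
qed

lemma next_index_bij: "bij_betw (\<lambda>i. Suc i mod n) {..<n} {..<n}"
proof (cases "n = 0")
  case False
  have "inj_on (\<lambda>i. Suc i mod n) {..<n}"
    by (rule inj_onI) (auto simp: mod_Suc split: if_splits)
  moreover have "(\<lambda>i. Suc i mod n) ` {..<n} \<subseteq> {..<n}" using False by auto
  ultimately show ?thesis by (simp add: bij_betw_def endo_inj_surj)
qed simp

text \<open>
  The vertices are listed as end points of the edges: the \<open>k\<close>-th edge contributes the weight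
  of its end point, the following edge starts there and contributes 1, and no other
  edge meets this vertex.
\<close>

lemma lookup_cycle_exponent:
  assumes "distinct xs" "length xs \<ge> 2" "i < length xs" "k < length xs"
  shows "Poly_Mapping.lookup (cycle_exponent xs w i) (xs ! (Suc k mod length xs)) =
    (if i = k then w (xs ! (Suc k mod length xs)) else if i = Suc k mod length xs then 1 else 0)"
proof -
  have "k \<noteq> Suc k mod length xs" using assms by (auto simp: mod_Suc)
  moreover have "Suc i mod length xs = Suc k mod length xs \<longleftrightarrow> i = k"
    using bij_betw_imp_inj_on[OF next_index_bij[of "length xs"]] assms by (auto dest: inj_onD)
  moreover have "Suc i mod length xs < length xs" "Suc k mod length xs < length xs"
    using assms(2) by (auto intro!: mod_less_divisor)
  ultimately show ?thesis
    using assms by (simp add: cycle_exponent_def lookup_add lookup_single when_def nth_eq_iff_index_eq)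
qed

lemma cycle_vertices_bij:
  assumes "distinct xs" "set xs = UNIV"
  shows "bij_betw (\<lambda>k. xs ! (Suc k mod length xs)) {..<length xs} UNIV"
  using bij_betw_trans[OF next_index_bij bij_betw_nth[OF assms(1), of "{..<length xs}" UNIV]] assms
  by (simp add: comp_def)

theorem theorem1p4:
  fixes E :: "('v::finite \<times> 'v) set" and w :: "'v \<Rightarrow> nat"
  assumes "weighted_oriented_graph E w"
    and "oriented_cycle E"
    and "\<And>v. w v \<ge> 2"
  shows "int (proj_dim (edge_ideal E w :: ('v, 'k::field) mpoly set)) = int (card E) - 1
    \<and> regularity (edge_ideal E w :: ('v, 'k) mpoly set)
        = (\<Sum>v\<in>UNIV. int (w v)) - int (card E) + 1"
proof -
  obtain xs where xs: "distinct xs" "set xs = UNIV" "length xs \<ge> 3"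
    and E: "E = {(xs ! i, xs ! (Suc i mod length xs)) | i. i < length xs}"
    using assms(2) by (auto simp: oriented_cycle_def)
  define n where "n = length xs"
  define y where "y k = xs ! (Suc k mod n)" for k
  define m where "m = cycle_exponent xs w"
  define d where "d A = int (monom_degree (exp_lcm m A))" for A
  have n: "n \<ge> 3" using xs by (simp add: n_def)
  have E_image: "E = (\<lambda>i. (xs ! i, y i)) ` {..<n}"
    by (auto simp: E n_def y_def)
  have card_E: "card E = n"
    unfolding E_image by (subst card_image) (auto simp: inj_on_def n_def nth_eq_iff_index_eq xs)
  have y_bij: "bij_betw y {..<n} UNIV"
    using cycle_vertices_bij[OF xs(1,2)] by (simp add: y_def[abs_def] n_def)
  have m_y: "Poly_Mapping.lookup (m i) (y k) = (if i = k then w (y k) else if i = Suc k mod n then 1 else 0)"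
    if "i < n" "k < n" for i k
    using lookup_cycle_exponent[OF xs(1)] xs(3) that by (simp add: m_def y_def n_def)
  \<comment> \<open>Without the edge that ends in y k, only the edge that starts there can contain this variable.\<close>
  have lcm_le_1: "Poly_Mapping.lookup (exp_lcm m A) (y k) \<le> 1" if "A \<subseteq> {..<n}" "k < n" "k \<notin> A" for A k
  proof -
    have "Poly_Mapping.lookup (m a) (y k) \<le> 1" if "a \<in> A" for a
      using \<open>a \<in> A\<close> \<open>A \<subseteq> {..<n}\<close> \<open>k < n\<close> \<open>k \<notin> A\<close> m_y[of a k] by (auto split: if_splits)
    then show ?thesis
      using finite_subset[OF \<open>A \<subseteq> {..<n}\<close>] by (simp add: lookup_exp_lcm_le)
  qed
  have "\<not> exp_le (m a) (exp_lcm m A)" if "A \<subseteq> {..<n}" "a \<in> {..<n} - A" for A a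
  proof
    assume "exp_le (m a) (exp_lcm m A)"
    then have "w (y a) \<le> Poly_Mapping.lookup (exp_lcm m A) (y a)"
      using m_y[of a a] that by (auto simp: exp_le_def dest: spec[of _ "y a"])
    then show False using lcm_le_1[of A a] that assms(3)[of "y a"] by simp
  qed
  then have betti: "betti (edge_ideal E w :: ('v, 'k) mpoly set) i j
      = card {A. A \<subseteq> {..<n} \<and> card A = Suc i \<and> d A = j}" for i j
    unfolding edge_ideal_cycle[OF E] d_def m_def n_def by (rule betti_taylor)
  have nonzero: "betti (edge_ideal E w :: ('v, 'k) mpoly set) i j \<noteq> 0
      \<longleftrightarrow> (\<exists>A\<subseteq>{..<n}. card A = Suc i \<and> d A = j)" for i j
  proof -
    have "finite {A. A \<subseteq> {..<n} \<and> card A = Suc i \<and> d A = j}"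
      by (rule finite_subset[of _ "Pow {..<n}"]) auto
    then show ?thesis by (auto simp: betti card_eq_0_iff)
  qed
  have d_sum: "d A = (\<Sum>k<n. int (Poly_Mapping.lookup (exp_lcm m A) (y k)))" for A
    by (simp add: d_def monom_degree_def sum.reindex_bij_betw[OF y_bij, symmetric])
  have w_sum: "(\<Sum>v\<in>UNIV. int (w v)) = (\<Sum>k<n. int (w (y k)))"
    by (rule sum.reindex_bij_betw[OF y_bij, symmetric])
  have d_le: "d A \<le> (\<Sum>v\<in>UNIV. int (w v)) - int n + int (card A)" if A: "A \<subseteq> {..<n}" for A
  proof -
    have fin: "finite A" using A finite_subset by blast
    \<comment> \<open>A missing edge lowers the exponent of its end point to at most 1, and the weight is at least 2.\<close>
    have "int (Poly_Mapping.lookup (exp_lcm m A) (y k)) \<le> int (w (y k)) - (if k \<in> A then 0 else 1)"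
      if "k < n" for k
    proof (cases "k \<in> A")
      case True
      have "Poly_Mapping.lookup (exp_lcm m A) (y k) \<le> w (y k)"
        unfolding lookup_exp_lcm_le[OF fin] using A that assms(3)[of "y k"] m_y[of _ k] by fastforce
      then show ?thesis using True by simp
    next
      case False
      then show ?thesis using lcm_le_1[OF A that] assms(3)[of "y k"] by simp
    qed
    then have "d A \<le> (\<Sum>k<n. int (w (y k)) - (if k \<in> A then 0 else 1))"
      unfolding d_sum by (intro sum_mono) auto
    also have "\<dots> = (\<Sum>k<n. int (w (y k)) - 1 + (if k \<in> A then 1 else 0))"
      by (intro sum.cong) auto
    also have "\<dots> = (\<Sum>v\<in>UNIV. int (w v)) - int n + (\<Sum>k<n. if k \<in> A then 1 else 0)"
      by (simp add: sum.distrib sum_subtractf w_sum)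
    also have "(\<Sum>k<n. if k \<in> A then 1 else 0) = int (card A)"
      using A by (simp add: sum.If_cases Int_absorb1)
    finally show ?thesis .
  qed
  have d_full: "d {..<n} = (\<Sum>v\<in>UNIV. int (w v))"
  proof (rule antisym)
    show "(\<Sum>v\<in>UNIV. int (w v)) \<le> d {..<n}"
      unfolding d_sum w_sum
    proof (rule sum_mono)
      fix k assume "k \<in> {..<n}"
      then show "int (w (y k)) \<le> int (Poly_Mapping.lookup (exp_lcm m {..<n}) (y k))"
        using exp_le_exp_lcm_member[of "{..<n}" k m] m_y[of k k] by (simp add: exp_le_def) metis
    qed
  qed (use d_le[of "{..<n}"] in simp)
  have "{i. \<exists>j. betti (edge_ideal E w :: ('v, 'k) mpoly set) i j \<noteq> 0} = {..<n}"
  proof (intro subset_antisym subsetI)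
    fix i assume "i \<in> {i. \<exists>j. betti (edge_ideal E w :: ('v, 'k) mpoly set) i j \<noteq> 0}"
    then obtain A where "A \<subseteq> {..<n}" "card A = Suc i"
      unfolding mem_Collect_eq nonzero by blast
    then show "i \<in> {..<n}" using card_mono[of "{..<n}" A] by simp
  next
    fix i assume "i \<in> {..<n}"
    then have "\<exists>A\<subseteq>{..<n}. card A = Suc i" by (intro exI[of _ "{..i}"]) auto
    then show "i \<in> {i. \<exists>j. betti (edge_ideal E w :: ('v, 'k) mpoly set) i j \<noteq> 0}"
      unfolding mem_Collect_eq nonzero by blast
  qed
  moreover have "Max {..<n} = n - 1"
    using n by (intro Max_eqI) auto
  ultimately have pd: "proj_dim (edge_ideal E w :: ('v, 'k) mpoly set) = n - 1"
    by (simp add: proj_dim_def)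
  have "Max {j - int i | i j. betti (edge_ideal E w :: ('v, 'k) mpoly set) i j \<noteq> 0}
      = (\<Sum>v\<in>UNIV. int (w v)) - int n + 1"
  proof (rule Max_eqI)
    have "r \<in> (\<lambda>A. d A - int (card A) + 1) ` Pow {..<n}"
      if "A \<subseteq> {..<n}" "card A = Suc i" "r = d A - int i" for r A i
      using that by (intro image_eqI[of _ _ A]) auto
    then have "{j - int i | i j. betti (edge_ideal E w :: ('v, 'k) mpoly set) i j \<noteq> 0}
        \<subseteq> (\<lambda>A. d A - int (card A) + 1) ` Pow {..<n}"
      unfolding nonzero by blast
    then show "finite {j - int i | i j. betti (edge_ideal E w :: ('v, 'k) mpoly set) i j \<noteq> 0}"
      using finite_subset by blast
  next
    fix r assume "r \<in> {j - int i | i j. betti (edge_ideal E w :: ('v, 'k) mpoly set) i j \<noteq> 0}"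
    then obtain A i where "A \<subseteq> {..<n}" "card A = Suc i" "r = d A - int i"
      unfolding mem_Collect_eq nonzero by blast
    then show "r \<le> (\<Sum>v\<in>UNIV. int (w v)) - int n + 1" using d_le[of A] by simp
  next
    have "\<exists>A\<subseteq>{..<n}. card A = Suc (n - 1) \<and> d A = (\<Sum>v\<in>UNIV. int (w v))"
      by (rule exI[of _ "{..<n}"]) (use n d_full in simp)
    then show "(\<Sum>v\<in>UNIV. int (w v)) - int n + 1
        \<in> {j - int i | i j. betti (edge_ideal E w :: ('v, 'k) mpoly set) i j \<noteq> 0}"
      unfolding mem_Collect_eq nonzero
      by (intro exI[of _ "n - 1"] exI[of _ "\<Sum>v\<in>UNIV. int (w v)"] conjI) (use n in linarith)
  qed
  then have "regularity (edge_ideal E w :: ('v, 'k) mpoly set) = (\<Sum>v\<in>UNIV. int (w v)) - int n + 1"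
    by (simp add: regularity_def)
  then show ?thesis using pd n by (simp add: card_E)
qed

end
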